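(* Let $d\ge 1$. (i) Let $A=a_dx^d+a_{d-1}x^{d-1}+\cdots+a_1x+a_0\in\mathbb{Z}[x]$ be an expanding polynomial with $a_0\ge 2$ that is monic in the sense that $a_d\in\{1,-1\}$, and let $\mathbf{r}=\big(\frac{a_d}{a_0},\frac{a_{d-1}}{a_0},\ldots,\frac{a_1}{a_0}\big)$. Then the central SRS tile $\mathcal{T}_\mathbf{r}(\mathbf{0})$ is the image of the self-affine tile $\mathcal{F}_A$ under a linear map $\mathbb{R}^d\to\mathbb{R}^d$. (ii) Let $\beta$ be a unit Pisot number of degree $d+1$, with minimal polynomial $(x-\beta)(x^d+r_{d-1}x^{d-1}+\cdots+r_1x+r_0)$, and let $\mathbf{r}=(r_0,\ldots,r_{d-1})$. Then the central SRS tile $\mathcal{T}_\mathbf{r}(\mathbf{0})$ is the image of the central $\beta$-tile $\mathcal{R}_\beta(0)$ under a linear map $\mathbb{R}^d\to\mathbb{R}^d$.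
   Context: SRS tiles. For $\mathbf{r}=(r_0,\ldots,r_{d-1})\in\mathbb{R}^d$ and $\mathbf{z}=(z_0,\ldots,z_{d-1})^t\in\mathbb{Z}^d$ put $\mathbf{r}\mathbf{z}=\sum_i r_iz_i$ and $\tau_\mathbf{r}(\mathbf{z})=(z_1,\ldots,z_{d-1},-\lfloor\mathbf{r}\mathbf{z}\rfloor)^t$, a map $\mathbb{Z}^d\to\mathbb{Z}^d$; $\tau_\mathbf{r}^{-n}(\mathbf{x})=\{\mathbf{z}\in\mathbb{Z}^d\mid\tau_\mathbf{r}^n(\mathbf{z})=\mathbf{x}\}$. The companion matrix $M_\mathbf{r}\in\mathbb{R}^{d\times d}$ has last row $(-r_0,-r_1,\ldots,-r_{d-1})$, entries $1$ on the superdiagonal of the first $d-1$ rows, and $0$ elsewhere (for $d=1$, $M_\mathbf{r}=(-r_0)$). If $r_0\ne0$ and $M_\mathbf{r}$ has spectral radius $<1$ (which holds in both cases of the claim), the SRS tile of $\mathbf{x}\in\mathbb{Z}^d$ is $\mathcal{T}_\mathbf{r}(\mathbf{x})=\mathrm{Li}_{n\to\infty}M_\mathbf{r}^n\tau_\mathbf{r}^{-n}(\mathbf{x})$, where the lower Hausdorff limit $\mathrm{Li}_{n\to\infty}A_n$ of subsets $A_n\subseteq\mathbb{R}^d$ is the set of all $\mathbf{t}\in\mathbb{R}^d$ such that each neighbourhood of $\mathbf{t}$ intersects $A_n$ for all sufficiently large $n$. The central SRS tile is $\mathcal{T}_\mathbf{r}(\mathbf{0})$. Self-affine tile. A polynomial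 is expanding if all its complex roots have modulus strictly larger than $1$. For $A$ as in (i), let $V\in\mathbb{R}^{d\times d}$ be the upper triangular matrix with entries $V_{ij}=a_{d-(j-i)}$ for $1\le i\le j\le d$ and $V_{ij}=0$ for $i>j$, let $B=VM_\mathbf{r}^{-1}V^{-1}$, $\mathcal{N}=\{0,\ldots,a_0-1\}$, and $\mathcal{F}_A=\big\{\sum_{i=1}^\infty B^{-i}(c_i,0,\ldots,0)^t\mid c_i\in\mathcal{N}\big\}\subset\mathbb{R}^d$. Beta-tile. A Pisot number is an algebraic integer $\beta>1$ all of whose other Galois conjugates have modulus $<1$; it is a unit if the constant coefficient of its minimal polynomial is $\pm1$. $T_\beta:[0,1)\to[0,1)$, $T_\beta(x)=\beta x-\lfloor\beta x\rfloor$, and $T_\beta^{-n}(x)=\{y\in[0,1)\mid T_\beta^n(y)=x\}$. Let $\beta_1,\ldots,\beta_d$, $d=p+2s$, be the Galois conjugates of $\beta$ other than $\beta$, with $\beta_1,\ldots,\beta_p$ real and $\beta_{p+1},\ldots,\beta_{p+2s}$ non-real, $\beta_{p+j}=\overline{\beta_{p+s+j}}$ for $1\le j\le s$. For $x\in\mathbb{Q}(\beta)$ let $x^{(j)}$ be the image of $x$ under the field isomorphism $\mathbb{Q}(\beta)\to\mathbb{Q}(\beta_j)$, $\beta\mapsto\beta_j$, and $\Phi_\beta(x)=\big(x^{(1)},\ldots,x^{(p)},\Re x^{(p+1)},\Im x^{(p+1)},\ldots,\Re x^{(p+s)},\Im x^{(p+s)}\big)^t\in\mathbb{R}^d$. The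 central $\beta$-tile is $\mathcal{R}_\beta(0)=\mathrm{Lim}_{n\to\infty}\Phi_\beta\big(\beta^nT_\beta^{-n}(0)\big)$, the limit being taken in the Hausdorff metric on non-empty compact subsets of $\mathbb{R}^d$ (it exists). *)

theory Defs
  imports "HOL-Analysis.Analysis" "HOL-Computational_Algebra.Computational_Algebra"
begin

text \<open>
  Throughout, the space of dimension \<open>d \<ge> 1\<close> is \<open>real ^ 'n\<close> with \<open>'n :: {finite, linorder}\<close>
  and \<open>d = CARD('n)\<close>. The linear order on the index type makes coordinates and matrix entries
  addressable by number: \<open>pos i\<close> is the 0-based position of the index \<open>i\<close>, so \<open>pos\<close> is a bijection
  from \<open>'n\<close> onto \<open>{0, \<dots>, d - 1}\<close>, and \<open>at_pos\<close> is its inverse.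
\<close>

definition pos :: "'n::{finite, linorder} \<Rightarrow> nat" where
  "pos i = card {j. j < i}"

definition at_pos :: "nat \<Rightarrow> 'n::{finite, linorder}" where
  "at_pos k = inv pos k"

lemma pos_less_iff: "pos i < pos j \<longleftrightarrow> i < (j :: 'n::{finite, linorder})"
proof -
  have *: "pos i < pos j" if "i < j" for i j :: 'n
    unfolding pos_def using that by (intro psubset_card_mono) auto
  show ?thesis
    using *[of i j] *[of j i] by (metis less_asym less_irrefl neqE)
qed

lemma bij_betw_pos: "bij_betw pos (UNIV :: 'n::{finite, linorder} set) {..<CARD('n)}"
proof -
  have inj: "inj (pos :: 'n \<Rightarrow> nat)"
    by (rule injI) (metis less_irrefl neqE pos_less_iff)
  have sub: "range (pos :: 'n \<Rightarrow> nat) \<subseteq> {..<CARD('n)}"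
    unfolding pos_def by (auto intro!: psubset_card_mono)
  have "range (pos :: 'n \<Rightarrow> nat) = {..<CARD('n)}"
    using sub inj by (intro card_subset_eq) (auto simp: card_image)
  with inj show ?thesis by (simp add: bij_betw_def)
qed


section \<open>Limits of sequences of sets\<close>

definition lower_hausdorff_lim :: "(nat \<Rightarrow> 'a::topological_space set) \<Rightarrow> 'a set" where
  "lower_hausdorff_lim X =
     {t. \<forall>U. open U \<and> t \<in> U \<longrightarrow> (\<forall>\<^sub>F n in sequentially. U \<inter> X n \<noteq> {})}"

text \<open>Only meaningful for non-empty bounded sets.\<close>

definition hausdorff_dist :: "'a::metric_space set \<Rightarrow> 'a set \<Rightarrow> real" where
  "hausdorff_dist A B = max (SUP a\<in>A. infdist a B) (SUP b\<in>B. infdist b A)"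

definition hausdorff_lim :: "(nat \<Rightarrow> 'a::metric_space set) \<Rightarrow> 'a set" where
  "hausdorff_lim X =
     (THE K. compact K \<and> K \<noteq> {} \<and> (\<lambda>n. hausdorff_dist (X n) K) \<longlonglongrightarrow> 0)"


section \<open>SRS tiles\<close>

definition int_vec :: "int ^ 'n::{finite, linorder} \<Rightarrow> real ^ 'n::{finite, linorder}" where
  "int_vec z = (\<chi> i. real_of_int (z $ i))"

definition srs_map :: "real ^ 'n::{finite, linorder} \<Rightarrow> int ^ 'n::{finite, linorder} \<Rightarrow> int ^ 'n::{finite, linorder}" where
  "srs_map r z = (\<chi> i. if Suc (pos i) < CARD('n) then z $ at_pos (Suc (pos i))
                       else - \<lfloor>\<Sum>j\<in>UNIV. r $ j * real_of_int (z $ j)\<rfloor>)"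

definition companion :: "real ^ 'n::{finite, linorder} \<Rightarrow> real ^ 'n::{finite, linorder} ^ 'n::{finite, linorder}" where
  "companion r = (\<chi> i j. if Suc (pos i) = CARD('n) then - (r $ j)
                         else if pos j = Suc (pos i) then 1 else 0)"

definition mat_power :: "real ^ 'n::{finite, linorder} ^ 'n::{finite, linorder} \<Rightarrow> nat \<Rightarrow> real ^ 'n::{finite, linorder} ^ 'n::{finite, linorder}" where
  "mat_power M n = (((**) M) ^^ n) (mat 1)"

text \<open>
  The defining formula makes sense for every \<open>r\<close>; SRS tiles are only considered when
  \<open>r\<^sub>0 \<noteq> 0\<close> and the companion matrix has spectral radius less than 1.
\<close>

definition srs_tile :: "real ^ 'n::{finite, linorder} \<Rightarrow> int ^ 'n::{finite, linorder} \<Rightarrow> (real ^ 'n::{finite, linorder}) set" where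
  "srs_tile r x =
     lower_hausdorff_lim
       (\<lambda>n. (\<lambda>z. mat_power (companion r) n *v int_vec z) ` {z. (srs_map r ^^ n) z = x})"


section \<open>Self-affine tiles of expanding polynomials\<close>

definition expanding :: "int poly \<Rightarrow> bool" where
  "expanding A \<longleftrightarrow> (\<forall>z::complex. poly (map_poly of_int A) z = 0 \<longrightarrow> cmod z > 1)"

text \<open>The vector \<open>(a\<^sub>d / a\<^sub>0, a\<^sub>d\<^sub>-\<^sub>1 / a\<^sub>0, \<dots>, a\<^sub>1 / a\<^sub>0)\<close>.\<close>

definition poly_srs_param :: "int poly \<Rightarrow> real ^ 'n::{finite, linorder}" where
  "poly_srs_param A =
     (\<chi> i. real_of_int (coeff A (CARD('n) - pos i)) / real_of_int (coeff A 0))"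

definition poly_V :: "int poly \<Rightarrow> real ^ 'n::{finite, linorder} ^ 'n::{finite, linorder}" where
  "poly_V A = (\<chi> i j. if pos i \<le> pos j
                      then real_of_int (coeff A (CARD('n) - (pos j - pos i))) else 0)"

definition poly_B :: "int poly \<Rightarrow> real ^ 'n::{finite, linorder} ^ 'n::{finite, linorder}" where
  "poly_B A = poly_V A ** matrix_inv (companion (poly_srs_param A)) ** matrix_inv (poly_V A)"

definition self_affine_tile :: "int poly \<Rightarrow> (real ^ 'n::{finite, linorder}) set" where
  "self_affine_tile A =
     {t. \<exists>c :: nat \<Rightarrow> int. (\<forall>i\<ge>1. c i \<in> {0..coeff A 0 - 1}) \<and>
           (\<lambda>i. mat_power (matrix_inv (poly_B A)) (Suc i) *v
                  (\<chi> k. if pos k = 0 then real_of_int (c (Suc i)) else 0)) sums t}"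


section \<open>Pisot numbers and beta-tiles\<close>

definition min_poly :: "'a::field_char_0 \<Rightarrow> rat poly" where
  "min_poly x = (THE p. lead_coeff p = 1 \<and> irreducible p \<and> poly (map_poly of_rat p) x = 0)"

definition galois_conjugates :: "real \<Rightarrow> complex set" where
  "galois_conjugates \<beta> = {z. poly (map_poly of_rat (min_poly \<beta>)) z = 0}"

definition pisot :: "real \<Rightarrow> bool" where
  "pisot \<beta> \<longleftrightarrow> algebraic_int \<beta> \<and> \<beta> > 1 \<and>
     (\<forall>z \<in> galois_conjugates \<beta> - {complex_of_real \<beta>}. cmod z < 1)"

definition unit_pisot :: "real \<Rightarrow> bool" where
  "unit_pisot \<beta> \<longleftrightarrow> pisot \<beta> \<and> coeff (min_poly \<beta>) 0 \<in> {1, - 1}"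

text \<open>The field \<open>\<rat>(x)\<close>, as the smallest subfield containing \<open>x\<close>.\<close>

definition is_subfield :: "'a::field_char_0 set \<Rightarrow> bool" where
  "is_subfield K \<longleftrightarrow> 0 \<in> K \<and> 1 \<in> K \<and>
     (\<forall>x\<in>K. \<forall>y\<in>K. x + y \<in> K \<and> x * y \<in> K) \<and> (\<forall>x\<in>K. - x \<in> K \<and> inverse x \<in> K)"

definition rat_adjoin :: "'a::field_char_0 \<Rightarrow> 'a set" where
  "rat_adjoin x = \<Inter>{K. is_subfield K \<and> x \<in> K}"

definition field_iso :: "('a::field_char_0 \<Rightarrow> 'b::field_char_0) \<Rightarrow> 'a set \<Rightarrow> 'b set \<Rightarrow> bool" where
  "field_iso \<sigma> K L \<longleftrightarrow> bij_betw \<sigma> K L \<and> \<sigma> 1 = 1 \<and>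
     (\<forall>x\<in>K. \<forall>y\<in>K. \<sigma> (x + y) = \<sigma> x + \<sigma> y \<and> \<sigma> (x * y) = \<sigma> x * \<sigma> y)"

text \<open>
  The image of \<open>x \<in> \<rat>(\<beta>)\<close> under the field isomorphism \<open>\<rat>(\<beta>) \<rightarrow> \<rat>(z)\<close> that sends \<open>\<beta>\<close> to its
  conjugate \<open>z\<close>; that isomorphism is uniquely determined on \<open>\<rat>(\<beta>)\<close> only, hence the description
  of its value rather than of the function.
\<close>

definition conj_image :: "real \<Rightarrow> complex \<Rightarrow> real \<Rightarrow> complex" where
  "conj_image \<beta> z x =
     (THE y. \<exists>\<sigma>. field_iso \<sigma> (rat_adjoin \<beta>) (rat_adjoin z) \<and> \<sigma> \<beta> = z \<and> y = \<sigma> x)"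

text \<open>
  \<open>conj_ordering d \<beta> p s b\<close>: \<open>b 1, \<dots>, b d\<close> lists the conjugates other than \<open>\<beta>\<close>, the \<open>p\<close> real
  ones first, followed by \<open>s\<close> pairwise non-conjugate non-real ones and then their complex
  conjugates.
\<close>

definition conj_ordering :: "nat \<Rightarrow> real \<Rightarrow> nat \<Rightarrow> nat \<Rightarrow> (nat \<Rightarrow> complex) \<Rightarrow> bool" where
  "conj_ordering d \<beta> p s b \<longleftrightarrow> d = p + 2 * s \<and>
     bij_betw b {1..d} (galois_conjugates \<beta> - {complex_of_real \<beta>}) \<and>
     (\<forall>j\<in>{1..p}. b j \<in> \<real>) \<and> (\<forall>j\<in>{p + 1..p + 2 * s}. b j \<notin> \<real>) \<and>
     (\<forall>j\<in>{1..s}. b (p + j) = cnj (b (p + s + j)))"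

text \<open>
  After the first \<open>p\<close> coordinates, the coordinates at the 0-based positions \<open>p + 2 * m\<close> and
  \<open>p + 2 * m + 1\<close> are the real and the imaginary part of \<open>x\<^sup>(\<^sup>p\<^sup>+\<^sup>m\<^sup>+\<^sup>1\<^sup>)\<close>.
\<close>

definition beta_embed ::
    "real \<Rightarrow> nat \<Rightarrow> (nat \<Rightarrow> complex) \<Rightarrow> real \<Rightarrow> real ^ 'n::{finite, linorder}" where
  "beta_embed \<beta> p b x =
     (\<chi> i. if pos i < p then Re (conj_image \<beta> (b (pos i + 1)) x)
           else let m = (pos i - p) div 2; y = conj_image \<beta> (b (p + m + 1)) x
                in if even (pos i - p) then Re y else Im y)"

definition beta_map :: "real \<Rightarrow> real \<Rightarrow> real" where
  "beta_map \<beta> x = \<beta> * x - real_of_int \<lfloor>\<beta> * x\<rfloor>"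

definition central_beta_tile ::
    "real \<Rightarrow> nat \<Rightarrow> (nat \<Rightarrow> complex) \<Rightarrow> (real ^ 'n::{finite, linorder}) set" where
  "central_beta_tile \<beta> p b =
     hausdorff_lim
       (\<lambda>n. (\<lambda>y. beta_embed \<beta> p b (\<beta> ^ n * y)) ` {y \<in> {0..<1}. (beta_map \<beta> ^^ n) y = 0})"

end

theory Submission
  imports Defs "HOL-Computational_Algebra.Field_as_Ring"
begin

text \<open>
  Put \<open>X\<^sub>n = M\<^sup>n \<tau>\<^sup>-\<^sup>n(0)\<close>. Since \<open>M z = \<tau> z - {r z} e\<^sub>d\<close>, the sets \<open>X\<^sub>n\<close> are described by the
  possible sequences of fractional parts \<open>{r \<tau>\<^sup>k z}\<close>.

  In the expanding case these sequences are arbitrary in \<open>{0, 1/a\<^sub>0, \<dots>, (a\<^sub>0 - 1)/a\<^sub>0}\<close> because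
  \<open>a\<^sub>d\<close> is a unit, so the tile consists of the series \<open>- \<Sum> c\<^sub>j M\<^sup>j e\<^sub>d / a\<^sub>0\<close>; conjugation by \<open>V\<close>
  together with \<open>M e\<^sub>1 = - r\<^sub>0 e\<^sub>d\<close> turns this into the self-affine tile.

  In the Pisot case \<open>z \<mapsto> y = {r z}\<close> conjugates \<open>\<tau>\<close> to \<open>T\<^sub>\<beta>\<close> on \<open>\<int>[\<beta>] \<inter> [0, 1)\<close>, which contains every
  \<open>T\<^sub>\<beta>\<^sup>-\<^sup>n(0)\<close> as \<open>\<beta>\<close> is a unit. If \<open>u\<close> is the left eigenvector of \<open>M\<close> belonging to the conjugate
  \<open>x\<close> of \<open>\<beta>\<close>, then the image of \<open>y\<close> under \<open>\<beta> \<mapsto> x\<close> is \<open>(x - \<beta>) u(z) + y\<close>, so that \<open>\<beta>\<^sup>n y\<close> is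
  sent to \<open>(x - \<beta>) u(M\<^sup>n z) + x\<^sup>n y\<close>. Up to an error tending to 0, the sets \<open>\<Phi>(\<beta>\<^sup>n T\<^sub>\<beta>\<^sup>-\<^sup>n(0))\<close> are
  therefore the images of \<open>X\<^sub>n\<close> under one linear isomorphism. They increase with \<open>n\<close> and are bounded,
  hence their Hausdorff limit and their lower limit both are the closure of the union.
\<close>

section \<open>Limits of increasing sequences of sets\<close>

lemma mem_lower_hausdorff_lim_iff:
  fixes X :: "nat \<Rightarrow> 'a::metric_space set"
  shows "t \<in> lower_hausdorff_lim X \<longleftrightarrow> (\<forall>e>0. \<forall>\<^sub>F n in sequentially. \<exists>a\<in>X n. dist a t < e)"
proof
  assume t: "t \<in> lower_hausdorff_lim X"
  show "\<forall>e>0. \<forall>\<^sub>F n in sequentially. \<exists>a\<in>X n. dist a t < e"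
  proof (intro allI impI)
    fix e :: real assume "e > 0"
    then have "\<forall>\<^sub>F n in sequentially. ball t e \<inter> X n \<noteq> {}"
      using t unfolding lower_hausdorff_lim_def by auto
    then show "\<forall>\<^sub>F n in sequentially. \<exists>a\<in>X n. dist a t < e"
      by eventually_elim (auto simp: dist_commute)
  qed
next
  assume *: "\<forall>e>0. \<forall>\<^sub>F n in sequentially. \<exists>a\<in>X n. dist a t < e"
  show "t \<in> lower_hausdorff_lim X"
    unfolding lower_hausdorff_lim_def
  proof (intro CollectI allI impI, elim conjE)
    fix U assume "open U" "t \<in> U"
    then obtain e where e: "e > 0" "ball t e \<subseteq> U"
      by (meson openE)
    from * e(1) have "\<forall>\<^sub>F n in sequentially. \<exists>a\<in>X n. dist a t < e" by blast
    then show "\<forall>\<^sub>F n in sequentially. U \<inter> X n \<noteq> {}"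
    proof eventually_elim
      case (elim n)
      then obtain a where "a \<in> X n" "a \<in> ball t e" by (auto simp: dist_commute)
      then show ?case using e(2) by blast
    qed
  qed
qed

text \<open>Once a neighbourhood meets one set of an increasing sequence it meets all later ones, so
  "for some n" and "eventually" coincide.\<close>

lemma lower_hausdorff_lim_incseq:
  fixes X :: "nat \<Rightarrow> 'a::metric_space set"
  assumes "incseq X"
  shows "lower_hausdorff_lim X = closure (\<Union>n. X n)"
proof (intro equalityI subsetI)
  fix t assume t: "t \<in> lower_hausdorff_lim X"
  show "t \<in> closure (\<Union>n. X n)"
    unfolding closure_approachable
  proof (intro allI impI)
    fix e :: real assume "e > 0"
    with t have "\<forall>\<^sub>F n in sequentially. \<exists>a\<in>X n. dist a t < e"
      unfolding mem_lower_hausdorff_lim_iff by blast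
    then obtain n where "\<exists>a\<in>X n. dist a t < e"
      using eventually_happens' sequentially_bot by blast
    then show "\<exists>y\<in>\<Union>n. X n. dist y t < e" by blast
  qed
next
  fix t assume t: "t \<in> closure (\<Union>n. X n)"
  show "t \<in> lower_hausdorff_lim X"
    unfolding mem_lower_hausdorff_lim_iff
  proof (intro allI impI)
    fix e :: real assume "e > 0"
    with t obtain a n where "a \<in> X n" "dist a t < e"
      unfolding closure_approachable by blast
    then show "\<forall>\<^sub>F n in sequentially. \<exists>a\<in>X n. dist a t < e"
      unfolding eventually_sequentially using assms by (meson incseqD subsetD)
  qed
qed

text \<open>Serves to compare two approximating sequences that match under a bi-Lipschitz bijection
  only up to an error tending to 0. One half of the tolerance is spent on the distortion, the other
  on \<open>\<delta> n\<close>.\<close>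

lemma lower_hausdorff_lim_perturb:
  fixes X :: "nat \<Rightarrow> 'a::metric_space set" and f :: "'a \<Rightarrow> 'b::metric_space"
  assumes fg: "\<And>x. g (f x) = x" "\<And>x. f (g x) = x"
    and f: "K-lipschitz_on UNIV f" and g: "K'-lipschitz_on UNIV g"
    and \<delta>: "\<delta> \<longlonglongrightarrow> 0"
    and XY: "\<And>n a. a \<in> X n \<Longrightarrow> \<exists>b\<in>Y n. dist (f a) b \<le> \<delta> n"
    and YX: "\<And>n b. b \<in> Y n \<Longrightarrow> \<exists>a\<in>X n. dist (f a) b \<le> \<delta> n"
  shows "lower_hausdorff_lim X = g ` lower_hausdorff_lim Y"
proof -
  have KK: "K \<ge> 0" "K' \<ge> 0" using f g lipschitz_on_nonneg by blast+
  \<comment> \<open>\<open>K\<close> and \<open>K'\<close> may be 0; the enlarged constants can be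
    divided by.\<close>
  have lip: "dist (f x) (f y) \<le> (K + 1) * dist x y" "dist (g u) (g v) \<le> (K' + 1) * dist u v" for x y u v
  proof -
    have "dist (f x) (f y) \<le> K * dist x y" "dist (g u) (g v) \<le> K' * dist u v"
      using f g by (auto simp: lipschitz_on_def)
    then show "dist (f x) (f y) \<le> (K + 1) * dist x y" "dist (g u) (g v) \<le> (K' + 1) * dist u v"
      by (simp_all add: distrib_right add_increasing2)
  qed
  have iff: "t \<in> lower_hausdorff_lim X \<longleftrightarrow> f t \<in> lower_hausdorff_lim Y" for t
  proof
    assume t: "t \<in> lower_hausdorff_lim X"
    show "f t \<in> lower_hausdorff_lim Y"
      unfolding mem_lower_hausdorff_lim_iff
    proof (intro allI impI)
      fix e :: real assume e: "e > 0"
      have "\<forall>\<^sub>F n in sequentially. \<exists>a\<in>X n. dist a t < e / (2 * (K + 1))"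
        using t e KK unfolding mem_lower_hausdorff_lim_iff by simp
      moreover have "\<forall>\<^sub>F n in sequentially. \<delta> n < e / 2"
        using order_tendstoD(2)[OF \<delta>, of "e/2"] e by simp
      ultimately show "\<forall>\<^sub>F n in sequentially. \<exists>b\<in>Y n. dist b (f t) < e"
      proof eventually_elim
        case (elim n)
        then obtain a where a: "a \<in> X n" "dist a t < e / (2 * (K + 1))" by blast
        from XY[OF a(1)] obtain b where b: "b \<in> Y n" "dist (f a) b \<le> \<delta> n" by blast
        have "dist b (f t) \<le> dist (f a) b + dist (f a) (f t)"
          by (metis dist_commute dist_triangle)
        also have "dist (f a) (f t) < e / 2"
          using lip(1)[of a t] a(2) KK by (simp add: field_simps)
        finally have "dist b (f t) < e" using b elim by simp
        then show ?case using b by blast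
      qed
    qed
  next
    assume t: "f t \<in> lower_hausdorff_lim Y"
    show "t \<in> lower_hausdorff_lim X"
      unfolding mem_lower_hausdorff_lim_iff
    proof (intro allI impI)
      fix e :: real assume e: "e > 0"
      have "\<forall>\<^sub>F n in sequentially. \<exists>b\<in>Y n. dist b (f t) < e / (2 * (K' + 1))"
        using t e KK unfolding mem_lower_hausdorff_lim_iff by simp
      moreover have "\<forall>\<^sub>F n in sequentially. \<delta> n < e / (2 * (K' + 1))"
        using order_tendstoD(2)[OF \<delta>, of "e / (2 * (K' + 1))"] e KK by simp
      ultimately show "\<forall>\<^sub>F n in sequentially. \<exists>a\<in>X n. dist a t < e"
      proof eventually_elim
        case (elim n)
        then obtain b where b: "b \<in> Y n" "dist b (f t) < e / (2 * (K' + 1))" by blast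
        from YX[OF b(1)] obtain a where a: "a \<in> X n" "dist (f a) b \<le> \<delta> n" by blast
        have "dist (f a) (f t) \<le> dist (f a) b + dist b (f t)"
          by (rule dist_triangle)
        also have "\<dots> < e / (2 * (K' + 1)) + e / (2 * (K' + 1))" using a b elim by linarith
        also have "\<dots> = e / (K' + 1)" using field_sum_of_halves[of "e / (K' + 1)"] by (simp only: divide_divide_eq_left mult.commute)
        finally have "(K' + 1) * dist (f a) (f t) < e" using KK by (simp add: field_simps)
        moreover have "dist a t \<le> (K' + 1) * dist (f a) (f t)"
          using lip(2)[of "f a" "f t"] by (simp add: fg)
        ultimately have "dist a t < e" by simp
        then show ?case using a by blast
      qed
    qed
  qed
  show ?thesis
  proof (intro equalityI subsetI)
    fix t assume "t \<in> lower_hausdorff_lim X"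
    then show "t \<in> g ` lower_hausdorff_lim Y" using iff fg by (metis imageI)
  next
    fix t assume "t \<in> g ` lower_hausdorff_lim Y"
    then show "t \<in> lower_hausdorff_lim X" using iff fg by force
  qed
qed

section \<open>Hausdorff distance and Hausdorff limits\<close>

text \<open>Boundedness makes the suprema in \<open>hausdorff_dist\<close> genuine: distances to a
  set are dominated by distances to any one of its points.\<close>

lemma infdist_le_hausdorff_dist:
  assumes "bounded A" "bounded B" "A \<noteq> {}" "B \<noteq> {}"
  shows "a \<in> A \<Longrightarrow> infdist a B \<le> hausdorff_dist A B" "b \<in> B \<Longrightarrow> infdist b A \<le> hausdorff_dist A B"
proof -
  have bdd: "bdd_above ((\<lambda>a. infdist a B) ` A)" if AB: "bounded A" "B \<noteq> {}" for A B :: "'a set"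
  proof -
    obtain b where b: "b \<in> B" using AB by blast
    obtain e where "\<And>a. a \<in> A \<Longrightarrow> dist b a \<le> e" using AB(1) bounded_any_center[of A b] by blast
    then show ?thesis
      by (intro bdd_aboveI[of _ e]) (auto simp: dist_commute intro!: order_trans[OF infdist_le[OF b]])
  qed
  show "infdist a B \<le> hausdorff_dist A B" if "a \<in> A"
    unfolding hausdorff_dist_def using cSUP_upper[OF that bdd] assms by (simp add: le_max_iff_disj)
  show "infdist b A \<le> hausdorff_dist A B" if "b \<in> B"
    unfolding hausdorff_dist_def using cSUP_upper[OF that bdd] assms by (simp add: le_max_iff_disj)
qed

lemma infdist_lessE:
  assumes "infdist x A < e" "A \<noteq> {}"
  obtains y where "y \<in> A" "dist x y < e"
proof -
  have "bdd_below (dist x ` A)" by (rule bdd_belowI[of _ 0]) auto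
  with assms show ?thesis using that by (auto simp: infdist_notempty cINF_less_iff)
qed

text \<open>A point of \<open>K\<close> is close to some point of \<open>X n\<close>, which in turn
  is close to \<open>L\<close>. Used in both directions, this is the uniqueness that the definite
  description in \<open>hausdorff_lim\<close> requires.\<close>

lemma hausdorff_lim_subset:
  fixes X :: "nat \<Rightarrow> 'a::heine_borel set"
  assumes K: "compact K" "K \<noteq> {}" "(\<lambda>n. hausdorff_dist (X n) K) \<longlonglongrightarrow> 0"
    and L: "compact L" "L \<noteq> {}" "(\<lambda>n. hausdorff_dist (X n) L) \<longlonglongrightarrow> 0"
    and X: "\<And>n. bounded (X n)" "\<And>n. X n \<noteq> {}"
  shows "K \<subseteq> L"
proof
  fix x assume x: "x \<in> K"
  have "x \<in> closure L"
    unfolding closure_approachable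
  proof (intro allI impI)
    fix e :: real assume e: "e > 0"
    have "\<forall>\<^sub>F n in sequentially. hausdorff_dist (X n) K < e/2 \<and> hausdorff_dist (X n) L < e/2"
      using order_tendstoD(2)[OF K(3), of "e/2"] order_tendstoD(2)[OF L(3), of "e/2"] e
      by (intro eventually_conj) simp_all
    then obtain n where n: "hausdorff_dist (X n) K < e/2" "hausdorff_dist (X n) L < e/2"
      using eventually_happens' sequentially_bot by blast
    have "infdist x (X n) < e/2"
      using infdist_le_hausdorff_dist(2)[OF X(1)[of n] compact_imp_bounded[OF K(1)] X(2)[of n] K(2) x] n by simp
    then obtain y where y: "y \<in> X n" "dist x y < e/2"
      using infdist_lessE[OF _ X(2)[of n]] by blast
    have "infdist y L < e/2"
      using infdist_le_hausdorff_dist(1)[OF X(1)[of n] compact_imp_bounded[OF L(1)] X(2)[of n] L(2) y(1)] n by simp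
    then obtain z where z: "z \<in> L" "dist y z < e/2"
      using infdist_lessE[OF _ L(2)] by blast
    have "dist z x < e" using y z by (metis dist_commute dist_triangle_half_l)
    then show "\<exists>y\<in>L. dist y x < e" using z by blast
  qed
  then show "x \<in> L" using L(1) compact_imp_closed closure_closed by blast
qed

lemma hausdorff_lim_eqI:
  fixes X :: "nat \<Rightarrow> 'a::heine_borel set"
  assumes K: "compact K" "K \<noteq> {}" "(\<lambda>n. hausdorff_dist (X n) K) \<longlonglongrightarrow> 0"
    and X: "\<And>n. bounded (X n)" "\<And>n. X n \<noteq> {}"
  shows "hausdorff_lim X = K"
  unfolding hausdorff_lim_def
proof (rule the_equality)
  show "compact K \<and> K \<noteq> {} \<and> (\<lambda>n. hausdorff_dist (X n) K) \<longlonglongrightarrow> 0" using K by blast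
next
  fix L assume "compact L \<and> L \<noteq> {} \<and> (\<lambda>n. hausdorff_dist (X n) L) \<longlonglongrightarrow> 0"
  then show "L = K"
    using hausdorff_lim_subset[OF K _ _ _ X, of L] hausdorff_lim_subset[OF _ _ _ K X, of L] by blast
qed

text \<open>A finite e/4-net of the compact closure suffices: each net point is approximated by some
  \<open>X (N x)\<close>, and by monotonicity one index beyond all \<open>N x\<close> serves the
  whole net.\<close>

lemma hausdorff_lim_incseq:
  fixes X :: "nat \<Rightarrow> 'a::heine_borel set"
  assumes X: "incseq X" "\<And>n. X n \<noteq> {}" and bdd: "bounded (\<Union>n. X n)"
  shows "hausdorff_lim X = closure (\<Union>n. X n)"
proof (rule hausdorff_lim_eqI)
  define K where "K = closure (\<Union>n. X n)"
  show "compact (closure (\<Union>n. X n))" using bdd compact_closure by blast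
  then have cK: "compact K" by (simp add: K_def)
  have XK: "X n \<subseteq> K" for n unfolding K_def using closure_subset[of "\<Union>n. X n"] by blast
  have "X 0 \<noteq> {}" by (rule X(2))
  then have "(\<Union>n. X n) \<noteq> {}" by blast
  then show "closure (\<Union>n. X n) \<noteq> {}" by simp
  then have Kne: "K \<noteq> {}" by (simp add: K_def)
  show "bounded (X n)" for n using bdd by (rule bounded_subset) blast
  show "X n \<noteq> {}" for n by (rule X)
  have "(\<lambda>n. hausdorff_dist (X n) K) \<longlonglongrightarrow> 0"
  proof (rule LIMSEQ_I)
    fix e :: real assume e: "e > 0"
    have "\<exists>S. finite S \<and> S \<subseteq> K \<and> K \<subseteq> (\<Union>x\<in>S. ball x (e/4))"
      using seq_compact_imp_totally_bounded[of K] cK e by (simp add: compact_eq_seq_compact_metric)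
    then obtain S where S: "finite S" "S \<subseteq> K" "K \<subseteq> (\<Union>x\<in>S. ball x (e/4))" by blast
    have "\<forall>x\<in>S. \<exists>n. \<exists>y\<in>X n. dist y x < e/4"
    proof
      fix x assume "x \<in> S"
      then have "x \<in> closure (\<Union>n. X n)" using S(2) K_def by blast
      moreover have "e/4 > 0" using e by simp
      ultimately show "\<exists>n. \<exists>y\<in>X n. dist y x < e/4" unfolding closure_approachable by blast
    qed
    then obtain N where N: "\<And>x. x \<in> S \<Longrightarrow> \<exists>y\<in>X (N x). dist y x < e/4" by metis
    have *: "hausdorff_dist (X n) K < e" if n: "n \<ge> Max (insert 0 (N ` S))" for n
    proof -
      have "infdist b (X n) \<le> e/2" if b: "b \<in> K" for b
      proof -
        obtain x where x: "x \<in> S" "dist x b < e/4" using S(3) b by auto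
        obtain y where y: "y \<in> X (N x)" "dist y x < e/4" using N[OF x(1)] by blast
        have "N x \<le> n" using n S(1) x(1) by auto
        then have "y \<in> X n" using X(1) y(1) by (meson incseqD subsetD)
        then have "infdist b (X n) \<le> dist b y" by (rule infdist_le)
        also have "\<dots> \<le> dist y x + dist x b" by (metis dist_commute dist_triangle)
        finally show ?thesis using x y by simp
      qed
      then have "(SUP b\<in>K. infdist b (X n)) \<le> e/2" using Kne by (intro cSUP_least) auto
      moreover have "(SUP a\<in>X n. infdist a K) \<le> e/2"
        using e XK[of n] by (intro cSUP_least X) (auto simp: infdist_zero subset_iff)
      ultimately show ?thesis unfolding hausdorff_dist_def using e by simp
    qed
    moreover have "0 \<le> hausdorff_dist (X n) K" for n
    proof -
      obtain a where "a \<in> X n" using X(2)[of n] by blast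
      then have "infdist a K \<le> hausdorff_dist (X n) K"
        using infdist_le_hausdorff_dist(1)[OF bounded_subset[OF bdd] compact_imp_bounded[OF cK] X(2)[of n] Kne]
        by blast
      then show ?thesis using infdist_nonneg[of a K] by simp
    qed
    ultimately show "\<exists>no. \<forall>n\<ge>no. norm (hausdorff_dist (X n) K - 0) < e" by auto
  qed
  then show "(\<lambda>n. hausdorff_dist (X n) (closure (\<Union>n. X n))) \<longlonglongrightarrow> 0" by (simp add: K_def)
qed

section \<open>Linear recurrences\<close>

text \<open>Polynomials act on sequences with the indeterminate as left shift; the sequences
  annihilated by \<open>p\<close> are the solutions of the linear recurrence with characteristic
  polynomial \<open>p\<close>.\<close>

definition shift_action :: "'a::comm_ring_1 poly \<Rightarrow> (nat \<Rightarrow> 'a) \<Rightarrow> nat \<Rightarrow> 'a" where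
  "shift_action p x n = (\<Sum>i\<le>degree p. coeff p i * x (n + i))"

lemma shift_action_eq_sum_atMost:
  assumes "degree p \<le> N"
  shows "shift_action p x n = (\<Sum>i\<le>N. coeff p i * x (n + i))"
  unfolding shift_action_def using assms by (intro sum.mono_neutral_left) (auto simp: coeff_eq_0)

lemma shift_action_linear_mult:
  "shift_action ([:-c, 1:] * q) x n = shift_action q x (Suc n) - c * shift_action q x n"
proof -
  have deg: "degree ([:-c, 1:] * q) \<le> Suc (degree q)"
    by (rule order_trans[OF degree_mult_le]) simp
  have "shift_action ([:-c, 1:] * q) x n = (\<Sum>i\<le>Suc (degree q). coeff ([:-c, 1:] * q) i * x (n + i))"
    by (rule shift_action_eq_sum_atMost[OF deg])
  also have "\<dots> = (\<Sum>i\<le>Suc (degree q). coeff (pCons 0 q) i * x (n + i))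
      - c * (\<Sum>i\<le>Suc (degree q). coeff q i * x (n + i))"
    unfolding sum_distrib_left sum_subtractf[symmetric]
    by (intro sum.cong) (simp_all add: algebra_simps)
  also have "(\<Sum>i\<le>Suc (degree q). coeff (pCons 0 q) i * x (n + i)) = shift_action q x (Suc n)"
    unfolding shift_action_def by (subst sum.atMost_Suc_shift) simp
  also have "(\<Sum>i\<le>Suc (degree q). coeff q i * x (n + i)) = shift_action q x n"
    by (rule shift_action_eq_sum_atMost[symmetric]) simp
  finally show ?thesis .
qed

definition geom_decay :: "(nat \<Rightarrow> 'a::real_normed_vector) \<Rightarrow> bool" where
  "geom_decay x \<longleftrightarrow> (\<exists>C \<rho>. 0 < \<rho> \<and> \<rho> < 1 \<and> (\<forall>n. norm (x n) \<le> C * \<rho> ^ n))"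

lemma geom_decay_mono:
  fixes x :: "nat \<Rightarrow> 'a::real_normed_vector" and y :: "nat \<Rightarrow> 'b::real_normed_vector"
  assumes "geom_decay x" and K: "\<And>n. norm (y n) \<le> K * norm (x n)"
  shows "geom_decay y"
proof -
  obtain C \<rho> where *: "0 < \<rho>" "\<rho> < 1" "\<And>n. norm (x n) \<le> C * \<rho> ^ n"
    using assms unfolding geom_decay_def by blast
  have "norm (y n) \<le> (\<bar>K\<bar> * C) * \<rho> ^ n" for n
  proof -
    have "norm (y n) \<le> \<bar>K\<bar> * norm (x n)"
      using K[of n] by (rule order_trans) (intro mult_right_mono; simp)
    also have "\<dots> \<le> \<bar>K\<bar> * (C * \<rho> ^ n)" by (intro mult_left_mono *) simp
    finally show ?thesis by (simp add: mult.assoc)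
  qed
  then show ?thesis unfolding geom_decay_def using * by blast
qed

lemma geom_decay_imp_summable_norm:
  assumes "geom_decay x"
  shows "summable (\<lambda>n. norm (x n))"
proof -
  obtain C \<rho> where *: "0 < \<rho>" "\<rho> < 1" "\<And>n. norm (x n) \<le> C * \<rho> ^ n"
    using assms unfolding geom_decay_def by blast
  have "summable (\<lambda>n. C * \<rho> ^ n)" using * by (intro summable_mult summable_geometric) simp
  then show ?thesis by (rule summable_comparison_test') (use * in simp)
qed

text \<open>A rate strictly above both \<open>norm c\<close> and the decay rate of \<open>w\<close>
  avoids the resonant case of equal rates, where a polynomial factor would appear.\<close>

lemma geom_decay_first_order:
  fixes y :: "nat \<Rightarrow> 'a::real_normed_field"
  assumes w: "geom_decay w" and c: "norm c < 1" and y: "\<And>n. y (Suc n) = c * y n + w n"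
  shows "geom_decay y"
proof -
  obtain C \<rho> where *: "0 < \<rho>" "\<rho> < 1" "\<And>n. norm (w n) \<le> C * \<rho> ^ n"
    using w unfolding geom_decay_def by blast
  obtain \<sigma> where \<sigma>: "max (norm c) \<rho> < \<sigma>" "\<sigma> < 1" using dense[of "max (norm c) \<rho>" 1] c * by auto
  have C: "C \<ge> 0" using order_trans[OF norm_ge_zero *(3)[of 0]] by simp
  \<comment> \<open>The first entry starts the induction; the second gives
    \<open>norm c * D + C \<le> D * \<sigma>\<close>, which carries it on.\<close>
  define D where "D = max (norm (y 0)) (C / (\<sigma> - norm c))"
  have D: "C \<le> D * (\<sigma> - norm c)"
  proof -
    have "C / (\<sigma> - norm c) \<le> D" unfolding D_def by simp
    then show ?thesis using \<sigma> by (simp add: field_simps)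
  qed
  have "norm (y n) \<le> D * \<sigma> ^ n" for n
  proof (induction n)
    case 0
    show ?case by (simp add: D_def)
  next
    case (Suc n)
    have "norm (y (Suc n)) \<le> norm c * norm (y n) + norm (w n)"
      unfolding y by (metis norm_mult norm_triangle_ineq)
    also have "\<dots> \<le> norm c * (D * \<sigma> ^ n) + C * \<sigma> ^ n"
    proof (intro add_mono mult_left_mono Suc)
      have "norm (w n) \<le> C * \<rho> ^ n" by (rule *)
      also have "\<dots> \<le> C * \<sigma> ^ n" using \<sigma> * C by (intro mult_left_mono power_mono) auto
      finally show "norm (w n) \<le> C * \<sigma> ^ n" .
    qed simp
    also have "C * \<sigma> ^ n \<le> D * (\<sigma> - norm c) * \<sigma> ^ n"
      using D \<sigma> * by (intro mult_right_mono) auto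
    finally show ?case by (simp add: algebra_simps)
  qed
  moreover have "\<sigma> > 0" using \<sigma> * by linarith
  ultimately show ?thesis unfolding geom_decay_def using \<sigma> by blast
qed

text \<open>Induction on the degree, splitting off a root \<open>c\<close> by the fundamental
  theorem of algebra. With the cofactor \<open>p\<close>, the sequence
  \<open>shift_action p x\<close> obeys a first-order recurrence with ratio \<open>c\<close> and
  decaying forcing term \<open>shift_action q x\<close>.\<close>

lemma geom_decay_shift_action:
  fixes q :: "complex poly"
  assumes "q \<noteq> 0" "\<And>z. poly q z = 0 \<Longrightarrow> cmod z < 1" "geom_decay (shift_action q x)"
  shows "geom_decay x"
  using assms
proof (induction "degree q" arbitrary: q)
  case 0
  then obtain a where q: "q = [:a:]" "a \<noteq> 0" by (metis degree_eq_zeroE pCons_0_0)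
  show ?case
    by (rule geom_decay_mono[OF 0(4), of _ "inverse (cmod a)"])
       (use q in \<open>simp add: shift_action_def norm_mult mult.assoc[symmetric]\<close>)
next
  case (Suc m)
  have "\<not> constant (poly q)" using Suc.hyps(2) constant_degree[of q] by simp
  then obtain c where c: "poly q c = 0" using fundamental_theorem_of_algebra by blast
  then obtain p where p: "q = [:-c, 1:] * p" using poly_eq_0_iff_dvd by (metis dvdE)
  have p0: "p \<noteq> 0" using Suc.prems p by auto
  have "geom_decay (shift_action p x)"
  proof (rule geom_decay_first_order[OF Suc.prems(3)])
    show "cmod c < 1" using Suc.prems(2) c by blast
    show "shift_action p x (Suc n) = c * shift_action p x n + shift_action q x n" for n
      unfolding p shift_action_linear_mult by simp
  qed
  moreover have "degree q = Suc (degree p)"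
    unfolding p using p0 by (subst degree_mult_eq) auto
  then have "m = degree p" using Suc.hyps(2) by simp
  moreover have "cmod z < 1" if "poly p z = 0" for z
    by (rule Suc.prems(2)) (simp add: p that)
  ultimately show ?case using Suc.hyps(1)[OF _ p0] by blast
qed

section \<open>Companion matrices\<close>

lemma inj_pos: "inj (pos :: 'n::{finite, linorder} \<Rightarrow> nat)"
  using bij_betw_pos bij_betw_imp_inj_on by blast

lemma pos_less_card [simp]: "pos (i :: 'n::{finite, linorder}) < CARD('n)"
  using bij_betw_pos[where 'n = 'n] by (auto simp: bij_betw_def)

lemma at_pos_pos [simp]: "at_pos (pos i) = i"
  unfolding at_pos_def by (rule inv_f_f[OF inj_pos])

lemma pos_at_pos [simp]: "k < CARD('n) \<Longrightarrow> pos (at_pos k :: 'n::{finite, linorder}) = k"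
  unfolding at_pos_def using bij_betw_pos[where 'n = 'n] by (intro f_inv_into_f) (auto simp: bij_betw_def)

lemma sum_pos:
  fixes f :: "'n::{finite, linorder} \<Rightarrow> 'b::comm_monoid_add"
  shows "(\<Sum>i\<in>UNIV. f i) = (\<Sum>k<CARD('n). f (at_pos k))"
  using sum.reindex_bij_betw[OF bij_betw_pos[where 'n = 'n], of "\<lambda>k. f (at_pos k)"] by simp

lemma companion_mult_nth:
  fixes r v :: "real ^ 'n::{finite, linorder}"
  shows "(companion r *v v) $ i = (if Suc (pos i) < CARD('n) then v $ at_pos (Suc (pos i))
           else - (\<Sum>j\<in>UNIV. r $ j * v $ j))"
proof (cases "Suc (pos i) < CARD('n)")
  case True
  have "(companion r *v v) $ i = (\<Sum>j\<in>UNIV. if j = at_pos (Suc (pos i)) then v $ j else 0)"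
  proof -
    have "pos j = Suc (pos i) \<longleftrightarrow> j = at_pos (Suc (pos i))" for j :: 'n
      using True by (metis at_pos_pos pos_at_pos)
    then show ?thesis
      unfolding matrix_vector_mult_def companion_def using True
      by (simp add: if_distrib[of "\<lambda>a. a * _"] cong: if_cong)
  qed
  then show ?thesis using True by simp
next
  case False
  then have "Suc (pos i) = CARD('n)" using pos_less_card[of i] by linarith
  then show ?thesis
    unfolding matrix_vector_mult_def companion_def by (simp add: sum_negf)
qed

lemma mat_power_0 [simp]: "mat_power M 0 = mat 1"
  by (simp add: mat_power_def)

lemma mat_power_Suc: "mat_power M (Suc n) = M ** mat_power M n"
  by (simp add: mat_power_def)

lemma mat_power_Suc_right: "mat_power M (Suc n) = mat_power M n ** M"
  by (induction n) (simp_all add: mat_power_Suc matrix_mul_assoc)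

text \<open>The characteristic polynomial of \<open>companion r\<close>. In (i) it is the reciprocal
  polynomial of \<open>A\<close> divided by a_0, in (ii) the cofactor of x - \<beta> in the minimal
  polynomial.\<close>

definition companion_poly :: "real ^ 'n::{finite, linorder} \<Rightarrow> real poly" where
  "companion_poly r = monom 1 CARD('n) + (\<Sum>i\<in>UNIV. monom (r $ i) (pos i))"

lemma coeff_companion_poly:
  fixes r :: "real ^ 'n::{finite, linorder}"
  shows "coeff (companion_poly r) k =
    (if k < CARD('n) then r $ at_pos k else if k = CARD('n) then 1 else 0)"
proof -
  have "(\<Sum>i\<in>UNIV. coeff (monom (r $ i) (pos i)) k) =
      (\<Sum>i<CARD('n). if i = k then r $ at_pos i else 0)"
    unfolding sum_pos by (intro sum.cong) auto
  also have "\<dots> = (if k < CARD('n) then r $ at_pos k else 0)" by simp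
  finally show ?thesis by (auto simp: companion_poly_def coeff_sum)
qed

lemma degree_companion_poly [simp]:
  "degree (companion_poly (r :: real ^ 'n::{finite, linorder})) = CARD('n)"
  by (rule antisym) (auto intro!: degree_le le_degree simp: coeff_companion_poly)

text \<open>Each application of the companion matrix shifts the coordinates by one place, so an
  orbit is encoded in the scalar sequence of its first coordinates.\<close>

lemma mat_power_companion_nth:
  fixes r v :: "real ^ 'n::{finite, linorder}"
  assumes "k < CARD('n)"
  shows "(mat_power (companion r) n *v v) $ at_pos k = (mat_power (companion r) (n + k) *v v) $ at_pos 0"
  using assms
proof (induction k arbitrary: n)
  case 0
  show ?case by simp
next
  case (Suc k)
  have "(mat_power (companion r) n *v v) $ at_pos (Suc k) = (mat_power (companion r) (Suc n) *v v) $ at_pos k"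
    unfolding mat_power_Suc matrix_vector_mul_assoc[symmetric] using Suc.prems
    by (simp add: companion_mult_nth)
  also have "\<dots> = (mat_power (companion r) (Suc n + k) *v v) $ at_pos 0"
    using Suc by (intro Suc.IH) simp
  finally show ?case by simp
qed

text \<open>The Cayley-Hamilton relation for the first coordinates, read off from the last row of
  the matrix.\<close>

lemma mat_power_companion_recurrence:
  fixes r v :: "real ^ 'n::{finite, linorder}"
  shows "shift_action (companion_poly r) (\<lambda>n. (mat_power (companion r) n *v v) $ at_pos 0) n = 0"
proof -
  let ?x = "\<lambda>n. (mat_power (companion r) n *v v) $ at_pos 0"
  obtain m where m: "CARD('n) = Suc m" using zero_less_card_finite[where 'a = 'n] by (metis gr0_conv_Suc)
  have "?x (n + CARD('n)) = (mat_power (companion r) (Suc n) *v v) $ at_pos m"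
    using mat_power_companion_nth[of m r "Suc n" v] m by simp
  also have "\<dots> = - (\<Sum>k<CARD('n). r $ at_pos k * (mat_power (companion r) n *v v) $ at_pos k)"
    unfolding mat_power_Suc matrix_vector_mul_assoc[symmetric] companion_mult_nth using m
    by (simp add: sum_pos)
  also have "(\<Sum>k<CARD('n). r $ at_pos k * (mat_power (companion r) n *v v) $ at_pos k)
      = (\<Sum>k<CARD('n). r $ at_pos k * ?x (n + k))"
    using mat_power_companion_nth[of _ r n v] by (intro sum.cong refl arg_cong2[of _ _ _ _ "(*)"]) simp
  finally show ?thesis
    unfolding shift_action_def
    by (simp add: coeff_companion_poly lessThan_Suc_atMost[symmetric])
qed

text \<open>The first coordinates decay by their recurrence, and every other coordinate is a shift
  of that sequence. This takes the place of the spectral radius formula.\<close>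

lemma geom_decay_mat_power_companion:
  fixes r v :: "real ^ 'n::{finite, linorder}"
  assumes "\<And>z. poly (map_poly of_real (companion_poly r)) z = 0 \<Longrightarrow> cmod z < 1"
  shows "geom_decay (\<lambda>n. mat_power (companion r) n *v v)"
proof -
  let ?x = "\<lambda>n. (mat_power (companion r) n *v v) $ at_pos 0"
  let ?q = "map_poly complex_of_real (companion_poly r)"
  have "degree ?q = CARD('n)" by (simp add: degree_map_poly)
  then have "?q \<noteq> 0" by auto
  moreover have "geom_decay (shift_action ?q (\<lambda>n. complex_of_real (?x n)))"
  proof -
    have "shift_action ?q (\<lambda>n. complex_of_real (?x n)) n = of_real (shift_action (companion_poly r) ?x n)" for n
      unfolding shift_action_def by (simp add: coeff_map_poly degree_map_poly)
    then have "shift_action ?q (\<lambda>n. complex_of_real (?x n)) = (\<lambda>n. 0)"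
      by (auto simp: mat_power_companion_recurrence)
    moreover have "geom_decay (\<lambda>n. 0 :: complex)"
      unfolding geom_decay_def by (intro exI[of _ 0] exI[of _ "1/2"]) simp
    ultimately show ?thesis by simp
  qed
  ultimately have "geom_decay (\<lambda>n. complex_of_real (?x n))"
    using geom_decay_shift_action[of ?q "\<lambda>n. complex_of_real (?x n)"] assms by blast
  then obtain C \<rho> where *: "0 < \<rho>" "\<rho> < 1" "\<And>n. \<bar>?x n\<bar> \<le> C * \<rho> ^ n"
    unfolding geom_decay_def norm_of_real by blast
  have C: "C \<ge> 0" using order_trans[OF abs_ge_zero *(3)[of 0]] by simp
  have "norm (mat_power (companion r) n *v v) \<le> (real CARD('n) * C) * \<rho> ^ n" for n
  proof -
    have "norm (mat_power (companion r) n *v v) \<le> (\<Sum>i\<in>UNIV. \<bar>(mat_power (companion r) n *v v) $ i\<bar>)"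
      by (rule norm_le_l1_cart)
    also have "\<dots> \<le> (\<Sum>i\<in>(UNIV :: 'n set). C * \<rho> ^ n)"
    proof (intro sum_mono)
      fix i :: 'n
      have "\<bar>(mat_power (companion r) n *v v) $ i\<bar> = \<bar>?x (n + pos i)\<bar>"
        using mat_power_companion_nth[of "pos i" r n v] by simp
      also have "\<dots> \<le> C * \<rho> ^ (n + pos i)" by (rule *)
      also have "\<dots> \<le> C * \<rho> ^ n" using * C by (intro mult_left_mono power_decreasing) auto
      finally show "\<bar>(mat_power (companion r) n *v v) $ i\<bar> \<le> C * \<rho> ^ n" .
    qed
    finally show ?thesis by simp
  qed
  then show ?thesis unfolding geom_decay_def using * by blast
qed

section \<open>Series with digits\<close>

lemma compact_PiE_finite:
  assumes "finite (D :: 'b::t1_space set)"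
  shows "compact (PiE (UNIV :: 'a set) (\<lambda>_. D))"
proof -
  have "compactin (product_topology (\<lambda>_. euclidean) UNIV) (PiE (UNIV :: 'a set) (\<lambda>_. D))"
    using finite_imp_compact[OF assms] by (subst compactin_PiE) auto
  then show ?thesis unfolding euclidean_product_topology by simp
qed

text \<open>The set is the image of the compact space of digit sequences; the Weierstrass M-test
  makes the value of the series depend continuously on the digits.\<close>

lemma compact_digit_series:
  fixes w :: "nat \<Rightarrow> 'a::{banach, t2_space}"
  assumes D: "finite (D :: real set)" and w: "summable (\<lambda>j. norm (w j))"
  shows "compact {t. \<exists>c. (\<forall>j. c j \<in> D) \<and> (\<lambda>j. c j *\<^sub>R w j) sums t}"
proof -
  define P where "P = PiE (UNIV :: nat set) (\<lambda>_. D)"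
  obtain b where b: "\<And>x. x \<in> D \<Longrightarrow> \<bar>x\<bar> \<le> b"
    using finite_imp_bounded[OF D] by (auto simp: bounded_iff)
  have le: "norm (c j *\<^sub>R w j) \<le> b * norm (w j)" if "c \<in> P" for c j
    using that b by (auto simp: P_def PiE_def intro!: mult_right_mono)
  have sw: "summable (\<lambda>j. b * norm (w j))" using w by (rule summable_mult)
  have lim: "uniform_limit P (\<lambda>n c. \<Sum>j<n. c j *\<^sub>R w j) (\<lambda>c. \<Sum>j. c j *\<^sub>R w j) sequentially"
    by (rule Weierstrass_m_test[OF le sw])
  have "continuous_on P (\<lambda>c. \<Sum>j<n. c j *\<^sub>R w j)" for n
  proof (intro continuous_on_sum continuous_on_scaleR continuous_on_const)
    fix j :: nat
    have "continuous_on UNIV (\<lambda>c :: nat \<Rightarrow> real. c j)" by (rule continuous_on_product_coordinates)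
    then show "continuous_on P (\<lambda>c. c j)" by (rule continuous_on_subset) simp
  qed
  then have "continuous_on P (\<lambda>c. \<Sum>j. c j *\<^sub>R w j)"
    by (intro uniform_limit_theorem[OF _ lim]) simp_all
  then have "compact ((\<lambda>c. \<Sum>j. c j *\<^sub>R w j) ` P)"
    by (rule compact_continuous_image) (use compact_PiE_finite[OF D] in \<open>simp add: P_def\<close>)
  moreover have "(\<lambda>c. \<Sum>j. c j *\<^sub>R w j) ` P = {t. \<exists>c. (\<forall>j. c j \<in> D) \<and> (\<lambda>j. c j *\<^sub>R w j) sums t}"
  proof (intro equalityI subsetI)
    fix t assume "t \<in> (\<lambda>c. \<Sum>j. c j *\<^sub>R w j) ` P"
    then obtain c where c: "c \<in> P" "t = (\<Sum>j. c j *\<^sub>R w j)" by blast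
    have "summable (\<lambda>j. c j *\<^sub>R w j)" by (rule summable_comparison_test'[OF sw le[OF c(1)]])
    then have "(\<lambda>j. c j *\<^sub>R w j) sums t" unfolding c(2) by (rule summable_sums)
    moreover have "\<forall>j. c j \<in> D" using c(1) by (auto simp: P_def PiE_def)
    ultimately show "t \<in> {t. \<exists>c. (\<forall>j. c j \<in> D) \<and> (\<lambda>j. c j *\<^sub>R w j) sums t}" by blast
  next
    fix t assume "t \<in> {t. \<exists>c. (\<forall>j. c j \<in> D) \<and> (\<lambda>j. c j *\<^sub>R w j) sums t}"
    then obtain c where c: "\<forall>j. c j \<in> D" "(\<lambda>j. c j *\<^sub>R w j) sums t" by blast
    have "t = (\<Sum>j. c j *\<^sub>R w j)" using c(2) by (rule sums_unique)
    moreover have "c \<in> P" using c(1) by (simp add: P_def PiE_UNIV_domain)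
    ultimately show "t \<in> (\<lambda>c. \<Sum>j. c j *\<^sub>R w j) ` P" by blast
  qed
  ultimately show ?thesis by simp
qed

text \<open>Since 0 is a digit, the sets of partial sums increase and the limit is the closure of
  their union. Compactness keeps it inside the set of series; conversely each series is the limit of
  its partial sums.\<close>

lemma lower_hausdorff_lim_digit_sums:
  fixes w :: "nat \<Rightarrow> 'a::banach"
  assumes D: "finite (D :: real set)" "0 \<in> D" and w: "summable (\<lambda>j. norm (w j))"
    and X0: "X 0 = {0}" and XS: "\<And>n. X (Suc n) = {a + c *\<^sub>R w n | a c. a \<in> X n \<and> c \<in> D}"
  shows "lower_hausdorff_lim X = {t. \<exists>c. (\<forall>j. c j \<in> D) \<and> (\<lambda>j. c j *\<^sub>R w j) sums t}"
    (is "_ = ?K")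
proof -
  have X: "X n = {\<Sum>j<n. c j *\<^sub>R w j | c. \<forall>j. c j \<in> D}" for n
  proof (induction n)
    case 0
    show ?case using D(2) X0 by auto
  next
    case (Suc n)
    show ?case
    proof (intro equalityI subsetI)
      fix t assume "t \<in> X (Suc n)"
      then obtain c d where c: "\<forall>j. c j \<in> D" "d \<in> D" "t = (\<Sum>j<n. c j *\<^sub>R w j) + d *\<^sub>R w n"
        unfolding XS Suc by blast
      then have "t = (\<Sum>j<Suc n. (c(n := d)) j *\<^sub>R w j)" by simp
      moreover have "\<forall>j. (c(n := d)) j \<in> D" using c by simp
      ultimately show "t \<in> {\<Sum>j<Suc n. c j *\<^sub>R w j | c. \<forall>j. c j \<in> D}" by blast
    next
      fix t assume "t \<in> {\<Sum>j<Suc n. c j *\<^sub>R w j | c. \<forall>j. c j \<in> D}"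
      then obtain c where c: "\<forall>j. c j \<in> D" "t = (\<Sum>j<n. c j *\<^sub>R w j) + c n *\<^sub>R w n" by auto
      then show "t \<in> X (Suc n)" unfolding XS Suc by blast
    qed
  qed
  have "X n \<subseteq> X (Suc n)" for n
  proof
    fix a assume "a \<in> X n"
    moreover have "a = a + 0 *\<^sub>R w n" by simp
    ultimately show "a \<in> X (Suc n)" unfolding XS using D(2) by blast
  qed
  then have inc: "incseq X" by (rule incseq_SucI)
  have XK: "X n \<subseteq> ?K" for n
  proof
    fix t assume "t \<in> X n"
    then obtain c where c: "\<forall>j. c j \<in> D" "t = (\<Sum>j<n. c j *\<^sub>R w j)" unfolding X by blast
    \<comment> \<open>Padding with the digit 0 turns a finite sum into a series.\<close>
    define c' where "c' j = (if j < n then c j else 0)" for j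
    have "(\<lambda>j. c' j *\<^sub>R w j) sums (\<Sum>j<n. c' j *\<^sub>R w j)"
      by (rule sums_finite) (auto simp: c'_def)
    moreover have "(\<Sum>j<n. c' j *\<^sub>R w j) = t" unfolding c(2) by (intro sum.cong) (auto simp: c'_def)
    moreover have "\<forall>j. c' j \<in> D" using c(1) D(2) by (simp add: c'_def)
    ultimately show "t \<in> ?K" by auto
  qed
  have cl: "closed ?K" using compact_digit_series[OF D(1) w] by (rule compact_imp_closed)
  have "closure (\<Union>n. X n) \<subseteq> ?K" by (rule closure_minimal[OF UN_least[OF XK] cl])
  moreover have "?K \<subseteq> closure (\<Union>n. X n)"
  proof
    fix t assume "t \<in> ?K"
    then obtain c where c: "\<forall>j. c j \<in> D" "(\<lambda>n. \<Sum>j<n. c j *\<^sub>R w j) \<longlonglongrightarrow> t"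
      unfolding sums_def by blast
    have "(\<Sum>j<n. c j *\<^sub>R w j) \<in> (\<Union>n. X n)" for n
      by (rule UN_I[of n]) (use c(1) X[of n] in auto)
    then show "t \<in> closure (\<Union>n. X n)" using c(2)
      unfolding closure_sequential by (intro exI[of _ "\<lambda>n. \<Sum>j<n. c j *\<^sub>R w j"]) simp
  qed
  ultimately have "closure (\<Union>n. X n) = ?K" by (rule equalityI)
  then show ?thesis by (simp only: lower_hausdorff_lim_incseq[OF inc])
qed

section \<open>Triangular and conjugated matrices\<close>

text \<open>In the row of the largest index with a non-zero entry of \<open>x\<close>, only the
  diagonal term survives.\<close>

lemma upper_triangular_mult_eq_0:
  fixes A :: "'a::field ^ 'n::{finite, linorder} ^ 'n::{finite, linorder}"
  assumes upper: "\<And>i j. j < i \<Longrightarrow> A $ i $ j = 0" and diag: "\<And>i. A $ i $ i \<noteq> 0"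
    and x: "A *v x = 0"
  shows "x = 0"
proof (rule ccontr)
  assume "x \<noteq> 0"
  then have ne: "{i. x $ i \<noteq> 0} \<noteq> {}" by (auto simp: vec_eq_iff)
  define i where "i = Max {i. x $ i \<noteq> 0}"
  have i: "x $ i \<noteq> 0" using Max_in[OF _ ne] by (simp add: i_def)
  have max: "j \<le> i" if "x $ j \<noteq> 0" for j unfolding i_def using that by (intro Max_ge) auto
  have "0 = (\<Sum>j\<in>UNIV. A $ i $ j * x $ j)"
    using arg_cong[OF x, of "\<lambda>y. y $ i"] by (simp add: matrix_vector_mult_def)
  also have "\<dots> = (\<Sum>j\<in>UNIV. if j = i then A $ i $ i * x $ i else 0)"
  proof (intro sum.cong refl)
    fix j show "A $ i $ j * x $ j = (if j = i then A $ i $ i * x $ i else 0)"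
      using max[of j] upper[of j i] by (cases j i rule: linorder_cases) auto
  qed
  also have "\<dots> = A $ i $ i * x $ i" by simp
  finally show False using i diag[of i] by simp
qed

lemma invertibleI_ker:
  fixes A :: "'a::field ^ 'n ^ 'n"
  assumes "\<And>x. A *v x = 0 \<Longrightarrow> x = 0"
  shows "invertible A"
  using assms matrix_left_invertible_ker[of A] invertible_left_inverse[of A] by blast

lemma invertible_matrix_inv:
  assumes "invertible A"
  shows "A ** matrix_inv A = mat 1" "matrix_inv A ** A = mat 1"
  using someI_ex[OF assms[unfolded invertible_def]] unfolding matrix_inv_def by blast+

lemma matrix_inv_eqI:
  fixes A :: "'a::field ^ 'n ^ 'n"
  assumes "A ** B = mat 1"
  shows "matrix_inv A = B"
proof -
  have BA: "B ** A = mat 1" using assms matrix_left_right_inverse by blast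
  have inv: "invertible A" unfolding invertible_def using assms BA by blast
  have "matrix_inv A = matrix_inv A ** (A ** B)" by (simp add: assms)
  also have "\<dots> = B" by (simp add: matrix_mul_assoc invertible_matrix_inv(2)[OF inv])
  finally show ?thesis .
qed

text \<open>The inner factors \<open>W ** V\<close> cancel. Exponents start at 1, as in the series
  of the self-affine tile; exponent 0 would call for \<open>V ** W = mat 1\<close>.\<close>

lemma mat_power_conjugate:
  assumes "W ** V = mat 1"
  shows "mat_power (V ** M ** W) (Suc n) = V ** mat_power M (Suc n) ** W"
proof (induction n)
  case 0
  show ?case by (simp add: mat_power_Suc)
next
  case (Suc n)
  have "mat_power (V ** M ** W) (Suc (Suc n)) = V ** M ** W ** (V ** mat_power M (Suc n) ** W)"
    by (subst mat_power_Suc) (simp only: Suc)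
  also have "\<dots> = V ** M ** (W ** V) ** mat_power M (Suc n) ** W"
    by (simp only: matrix_mul_assoc)
  also have "\<dots> = V ** mat_power M (Suc (Suc n)) ** W"
    by (subst (2) mat_power_Suc) (simp add: assms matrix_mul_assoc)
  finally show ?case .
qed

section \<open>The shift radix system\<close>

definition last_unit :: "real ^ 'n::{finite, linorder}" where
  "last_unit = (\<chi> i. if Suc (pos i) = CARD('n) then 1 else 0)"

definition srs_dot :: "real ^ 'n::{finite, linorder} \<Rightarrow> int ^ 'n::{finite, linorder} \<Rightarrow> real" where
  "srs_dot r z = (\<Sum>j\<in>UNIV. r $ j * real_of_int (z $ j))"

text \<open>Both maps shift the first d - 1 coordinates; in the last one the floor in
  \<open>srs_map\<close> accounts for the fractional part.\<close>

lemma companion_mult_int_vec: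
  "companion r *v int_vec z = int_vec (srs_map r z) - frac (srs_dot r z) *\<^sub>R last_unit"
  unfolding vec_eq_iff
proof
  fix i :: 'a
  show "(companion r *v int_vec z) $ i = (int_vec (srs_map r z) - frac (srs_dot r z) *\<^sub>R last_unit) $ i"
    using le_neq_implies_less[OF Suc_leI[OF pos_less_card[of i]]]
    by (auto simp: companion_mult_nth int_vec_def srs_map_def srs_dot_def last_unit_def frac_def)
qed

lemma srs_map_nth_Suc:
  assumes "Suc k < CARD('n)"
  shows "srs_map r z $ at_pos k = (z :: int ^ 'n::{finite, linorder}) $ at_pos (Suc k)"
  using assms by (simp add: srs_map_def)

lemma srs_map_nth_last:
  assumes "Suc k = CARD('n)"
  shows "srs_map r (z :: int ^ 'n::{finite, linorder}) $ at_pos k = - \<lfloor>srs_dot r z\<rfloor>"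
  using assms by (simp add: srs_map_def srs_dot_def)

lemma vec_eq_at_posI:
  fixes x y :: "'a ^ 'n::{finite, linorder}"
  assumes "\<And>k. k < CARD('n) \<Longrightarrow> x $ at_pos k = y $ at_pos k"
  shows "x = y"
  unfolding vec_eq_iff using assms[OF pos_less_card] by simp

lemma srs_map_0 [simp]: "srs_map r 0 = 0"
  by (simp add: srs_map_def vec_eq_iff)

definition srs_approx :: "real ^ 'n::{finite, linorder} \<Rightarrow> nat \<Rightarrow> (real ^ 'n::{finite, linorder}) set" where
  "srs_approx r n = (\<lambda>z. mat_power (companion r) n *v int_vec z) ` {z. (srs_map r ^^ n) z = 0}"

lemma srs_approx_0: "srs_approx (r :: real ^ 'n::{finite, linorder}) 0 = {0}"
proof -
  have "int_vec (0 :: int ^ 'n::{finite, linorder}) = 0" by (simp add: int_vec_def vec_eq_iff)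
  then show ?thesis by (simp add: srs_approx_def)
qed

text \<open>Passing to a preimage appends one digit, as
  \<open>M^(n+1) z = M^n (\<tau> z) - {r z} M^n e_d\<close>. The second hypothesis, that each digit
  occurs over each point, makes all combinations available.\<close>

lemma srs_approx_Suc:
  assumes digit: "\<And>z. frac (srs_dot r z) \<in> D"
    and preimage: "\<And>x c. c \<in> D \<Longrightarrow> \<exists>z. srs_map r z = x \<and> frac (srs_dot r z) = c"
  shows "srs_approx r (Suc n) = {a - c *\<^sub>R (mat_power (companion r) n *v last_unit) | a c.
           a \<in> srs_approx r n \<and> c \<in> D}"
proof -
  have step: "mat_power (companion r) (Suc n) *v int_vec z = mat_power (companion r) n *v int_vec (srs_map r z)
      - frac (srs_dot r z) *\<^sub>R (mat_power (companion r) n *v last_unit)" for z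
    unfolding mat_power_Suc_right matrix_vector_mul_assoc[symmetric] companion_mult_int_vec
    by (simp add: matrix_vector_mult_diff_distrib matrix_vector_mult_scaleR)
  show ?thesis
  proof (intro equalityI subsetI)
    fix t assume "t \<in> srs_approx r (Suc n)"
    then obtain z where z: "(srs_map r ^^ Suc n) z = 0" "t = mat_power (companion r) (Suc n) *v int_vec z"
      unfolding srs_approx_def by blast
    have "(srs_map r ^^ n) (srs_map r z) = 0" using z(1) by (simp add: funpow_swap1)
    then have "mat_power (companion r) n *v int_vec (srs_map r z) \<in> srs_approx r n"
      unfolding srs_approx_def by blast
    then show "t \<in> {a - c *\<^sub>R (mat_power (companion r) n *v last_unit) | a c. a \<in> srs_approx r n \<and> c \<in> D}"
      using z(2) step[of z] digit[of z] by blast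
  next
    fix t assume "t \<in> {a - c *\<^sub>R (mat_power (companion r) n *v last_unit) | a c. a \<in> srs_approx r n \<and> c \<in> D}"
    then obtain x c where x: "(srs_map r ^^ n) x = 0" "c \<in> D"
      "t = mat_power (companion r) n *v int_vec x - c *\<^sub>R (mat_power (companion r) n *v last_unit)"
      unfolding srs_approx_def by blast
    obtain z where z: "srs_map r z = x" "frac (srs_dot r z) = c" using preimage[OF x(2)] by blast
    have "(srs_map r ^^ Suc n) z = 0" using x(1) z(1) by (simp add: funpow_swap1)
    moreover have "t = mat_power (companion r) (Suc n) *v int_vec z" using x(3) step[of z] z by simp
    ultimately show "t \<in> srs_approx r (Suc n)" unfolding srs_approx_def by blast
  qed
qed

section \<open>Expanding polynomials\<close>

context
  fixes A :: "int poly" and r :: "real ^ 'n::{finite, linorder}"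
  assumes degree_A: "degree A = CARD('n)" and expanding_A: "expanding A"
    and const_A: "coeff A 0 \<ge> 2" and lead_A: "lead_coeff A \<in> {1, - 1}"
    and r: "r = poly_srs_param A"
begin

lemma poly_srs_param_nth:
  "k < CARD('n) \<Longrightarrow> r $ at_pos k = real_of_int (coeff A (CARD('n) - k)) / real_of_int (coeff A 0)"
  by (simp add: r poly_srs_param_def)

lemma lead_coeff_square: "coeff A CARD('n) * coeff A CARD('n) = 1"
  using lead_A degree_A by auto

text \<open>Up to the factor a_0 the characteristic polynomial is the reciprocal polynomial of
  \<open>A\<close>, so its roots are inverses of roots of \<open>A\<close>.\<close>

lemma norm_root_companion_poly_less_1:
  assumes "poly (map_poly complex_of_real (companion_poly r)) z = 0"
  shows "cmod z < 1"
proof -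
  let ?A = "map_poly complex_of_int A"
  have a0: "coeff A 0 \<noteq> 0" using const_A by simp
  have degA: "degree ?A = CARD('n)" using degree_A by (simp add: degree_map_poly)
  have "smult (of_int (coeff A 0)) (map_poly complex_of_real (companion_poly r)) = reflect_poly ?A"
  proof (rule poly_eqI)
    fix k
    show "coeff (smult (of_int (coeff A 0)) (map_poly complex_of_real (companion_poly r))) k = coeff (reflect_poly ?A) k"
      using a0 degA
      by (auto simp: coeff_map_poly coeff_reflect_poly coeff_companion_poly poly_srs_param_nth)
  qed
  then have *: "poly (reflect_poly ?A) z = 0" using assms by (metis mult_zero_right poly_smult)
  \<comment> \<open>The constant coefficient of the reciprocal polynomial is a_d, which is not
    0.\<close>
  have "z \<noteq> 0"
  proof
    assume "z = 0"
    then have "coeff ?A CARD('n) = 0" using * degA by (simp add: poly_0_coeff_0 coeff_reflect_poly)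
    then show False using lead_coeff_square by (simp add: coeff_map_poly)
  qed
  then have "poly ?A (inverse z) = 0" using * by (simp add: poly_reflect_poly_nz)
  then have "1 < cmod (inverse z)" using expanding_A unfolding expanding_def by blast
  then show ?thesis using \<open>z \<noteq> 0\<close> by (simp add: norm_inverse one_less_inverse_iff)
qed

definition digits :: "real set" where
  "digits = (\<lambda>c. real_of_int c / real_of_int (coeff A 0)) ` {0..coeff A 0 - 1}"

text \<open>The first coordinate is kept apart because its coefficient is the unit a_d: it is the
  one unknown when a preimage is sought.\<close>

lemma srs_dot_eq:
  assumes m: "CARD('n) = Suc m"
  shows "srs_dot r z = real_of_int (coeff A CARD('n) * z $ at_pos 0
    + (\<Sum>k<m. coeff A (m - k) * z $ at_pos (Suc k))) / real_of_int (coeff A 0)"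
proof -
  have "srs_dot r z = (\<Sum>k<CARD('n). real_of_int (coeff A (CARD('n) - k) * z $ at_pos k)) / real_of_int (coeff A 0)"
    unfolding srs_dot_def sum_pos sum_divide_distrib
    by (intro sum.cong) (simp_all add: poly_srs_param_nth)
  then show ?thesis unfolding m sum.lessThan_Suc_shift by simp
qed

lemma frac_srs_dot_digits: "frac (srs_dot r z) \<in> digits"
proof -
  obtain m where m: "CARD('n) = Suc m" using zero_less_card_finite[where 'a = 'n] by (metis gr0_conv_Suc)
  obtain N where N: "srs_dot r z = real_of_int N / real_of_int (coeff A 0)" using srs_dot_eq[OF m] by blast
  have "frac (srs_dot r z) = real_of_int (N mod coeff A 0) / real_of_int (coeff A 0)"
    unfolding N using const_A
    by (simp add: frac_def floor_divide_of_int_eq field_simps minus_div_mult_eq_mod[symmetric])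
  moreover have "N mod coeff A 0 \<in> {0..coeff A 0 - 1}"
    using const_A pos_mod_bound[of "coeff A 0" N] pos_mod_sign[of "coeff A 0" N] by simp
  ultimately show ?thesis unfolding digits_def by blast
qed

text \<open>All coordinates of \<open>z\<close> but the first are forced by \<open>x\<close>. The
  first solves a linear equation with leading coefficient a_d, which has an integer solution for
  every digit because a_d is its own inverse.\<close>

lemma srs_preimage_digit:
  assumes "c \<in> digits"
  shows "\<exists>z. srs_map r z = x \<and> frac (srs_dot r z) = c"
proof -
  obtain m where m: "CARD('n) = Suc m" using zero_less_card_finite[where 'a = 'n] by (metis gr0_conv_Suc)
  let ?a0 = "coeff A 0" and ?ad = "coeff A CARD('n)"
  from assms obtain c' where c': "c = real_of_int c' / real_of_int ?a0" "0 \<le> c'" "c' < ?a0"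
    unfolding digits_def by auto
  define Z where "Z = (\<Sum>k<m. coeff A (m - k) * x $ at_pos k)"
  \<comment> \<open>The first coordinate is chosen so that
    \<open>srs_dot r z = c - x $ at_pos m\<close>; the floor then reproduces the last coordinate of
    \<open>x\<close>, and \<open>c\<close> remains as fractional part.\<close>
  define z :: "int ^ 'n::{finite, linorder}" where
    "z = (\<chi> i. if pos i = 0 then ?ad * (c' - Z - ?a0 * x $ at_pos m) else x $ at_pos (pos i - 1))"
  have z0: "z $ at_pos 0 = ?ad * (c' - Z - ?a0 * x $ at_pos m)" by (simp add: z_def)
  have zS: "z $ at_pos (Suc k) = x $ at_pos k" if "k < m" for k using that m by (simp add: z_def)
  have "(\<Sum>k<m. coeff A (m - k) * z $ at_pos (Suc k)) = Z"
    unfolding Z_def by (intro sum.cong) (simp_all add: zS)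
  moreover have "?ad * z $ at_pos 0 = c' - Z - ?a0 * x $ at_pos m"
    unfolding z0 mult.assoc[symmetric] lead_coeff_square by simp
  ultimately have "srs_dot r z = real_of_int (c' - ?a0 * x $ at_pos m) / real_of_int ?a0"
    unfolding srs_dot_eq[OF m] by simp
  then have dot: "srs_dot r z = c + real_of_int (- x $ at_pos m)"
    using const_A by (simp add: c'(1) field_simps)
  have c: "0 \<le> c" "c < 1" using c' const_A by simp_all
  then have fl: "\<lfloor>srs_dot r z\<rfloor> = - x $ at_pos m" unfolding dot by (simp add: floor_eq_iff)
  then have "frac (srs_dot r z) = c" using dot by (simp add: frac_def)
  moreover have "srs_map r z = x"
  proof (rule vec_eq_at_posI)
    fix k assume "k < CARD('n)"
    then consider "k < m" | "k = m" using m by linarith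
    then show "srs_map r z $ at_pos k = x $ at_pos k"
      by cases (use m fl in \<open>simp_all add: srs_map_nth_Suc srs_map_nth_last zS\<close>)
  qed
  ultimately show ?thesis by blast
qed

text \<open>The approximations are full digit sums over the vectors \<open>M^j e_d\<close>, whose
  norms are summable by the root bound. Digits are negated since each step subtracts.\<close>

lemma srs_tile_eq_digit_series:
  "srs_tile r 0 = {t. \<exists>c. (\<forall>j. c j \<in> uminus ` digits) \<and>
     (\<lambda>j. c j *\<^sub>R (mat_power (companion r) j *v last_unit)) sums t}"
proof -
  have "srs_tile r 0 = lower_hausdorff_lim (srs_approx r)"
    by (simp add: srs_tile_def srs_approx_def[abs_def])
  also have "\<dots> = {t. \<exists>c. (\<forall>j. c j \<in> uminus ` digits) \<and>
     (\<lambda>j. c j *\<^sub>R (mat_power (companion r) j *v last_unit)) sums t}"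
  proof (rule lower_hausdorff_lim_digit_sums)
    show "finite (uminus ` digits)" by (simp add: digits_def)
    show "0 \<in> uminus ` digits" unfolding digits_def using const_A by force
    show "summable (\<lambda>j. norm (mat_power (companion r) j *v (last_unit :: real ^ 'n::{finite, linorder})))"
      by (intro geom_decay_imp_summable_norm geom_decay_mat_power_companion norm_root_companion_poly_less_1)
    show "srs_approx r 0 = {0}" by (rule srs_approx_0)
    have minus: "{a - c *\<^sub>R w | a c. a \<in> X \<and> c \<in> digits} = {a + c *\<^sub>R w | a c. a \<in> X \<and> c \<in> uminus ` digits}"
      for w :: "real ^ 'n::{finite, linorder}" and X
    proof (intro equalityI subsetI)
      fix t assume "t \<in> {a - c *\<^sub>R w | a c. a \<in> X \<and> c \<in> digits}"
      then obtain a c where "a \<in> X" "c \<in> digits" "t = a + (- c) *\<^sub>R w" by auto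
      then show "t \<in> {a + c *\<^sub>R w | a c. a \<in> X \<and> c \<in> uminus ` digits}" by blast
    next
      fix t assume "t \<in> {a + c *\<^sub>R w | a c. a \<in> X \<and> c \<in> uminus ` digits}"
      then obtain a c where "a \<in> X" "c \<in> digits" "t = a - c *\<^sub>R w" by auto
      then show "t \<in> {a - c *\<^sub>R w | a c. a \<in> X \<and> c \<in> digits}" by blast
    qed
    show "srs_approx r (Suc n) = {a + c *\<^sub>R (mat_power (companion r) n *v last_unit) | a c.
        a \<in> srs_approx r n \<and> c \<in> uminus ` digits}" for n
      by (rule trans[OF srs_approx_Suc[where D = digits, OF frac_srs_dot_digits srs_preimage_digit] minus])
  qed
  finally show ?thesis .
qed

section \<open>Transfer to the self-affine tile\<close>

text \<open>The first column of the companion matrix contains only its bottom entry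
  \<open>- r_0 = - a_d / a_0\<close>, also when d = 1.\<close>

lemma companion_mult_first_unit:
  "companion r *v (\<chi> k. if pos k = 0 then c else 0) = - (c * real_of_int (coeff A CARD('n)) / real_of_int (coeff A 0)) *\<^sub>R last_unit"
  unfolding vec_eq_iff
proof
  fix i :: 'n
  have "(\<Sum>j\<in>UNIV. r $ j * (\<chi> k. if pos k = 0 then c else 0) $ j) = (\<Sum>k<CARD('n). if k = 0 then r $ at_pos 0 * c else 0)"
    unfolding sum_pos by (intro sum.cong) auto
  also have "\<dots> = c * real_of_int (coeff A CARD('n)) / real_of_int (coeff A 0)"
    by (simp add: poly_srs_param_nth)
  finally show "(companion r *v (\<chi> k. if pos k = 0 then c else 0)) $ i =
      (- (c * real_of_int (coeff A CARD('n)) / real_of_int (coeff A 0)) *\<^sub>R last_unit) $ i"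
    using le_neq_implies_less[OF Suc_leI[OF pos_less_card[of i]]]
    by (auto simp: companion_mult_nth last_unit_def)
qed

lemma poly_V_mult_first_unit:
  "poly_V A *v (\<chi> k :: 'n. if pos k = 0 then c else 0) = (\<chi> k. if pos k = 0 then real_of_int (coeff A CARD('n)) * c else 0)"
  unfolding vec_eq_iff
proof
  fix i :: 'n
  have "(poly_V A *v (\<chi> k :: 'n. if pos k = 0 then c else 0)) $ i =
      (\<Sum>k<CARD('n). if k = 0 then poly_V A $ i $ (at_pos 0) * c else 0)"
    unfolding matrix_vector_mult_def vec_lambda_beta sum_pos by (intro sum.cong) auto
  also have "\<dots> = (if pos i = 0 then real_of_int (coeff A CARD('n)) * c else 0)"
    by (simp add: poly_V_def)
  finally show "(poly_V A *v (\<chi> k :: 'n. if pos k = 0 then c else 0)) $ i =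
      (\<chi> k. if pos k = 0 then real_of_int (coeff A CARD('n)) * c else 0) $ i" by simp
qed

lemma invertible_poly_V: "invertible (poly_V A :: real ^ 'n::{finite, linorder} ^ 'n::{finite, linorder})"
proof (rule invertibleI_ker)
  have ad: "coeff A CARD('n) \<noteq> 0" using lead_coeff_square by auto
  fix x :: "real ^ 'n::{finite, linorder}" assume "poly_V A *v x = 0"
  then show "x = 0"
  proof (rule upper_triangular_mult_eq_0[rotated -1])
    show "poly_V A $ i $ j = (0 :: real)" if "j < i" for i j :: 'n
      using that by (simp add: poly_V_def pos_less_iff[symmetric])
    show "poly_V A $ i $ i \<noteq> (0 :: real)" for i :: 'n
      using ad by (simp add: poly_V_def)
  qed
qed

lemma invertible_companion: "invertible (companion r)"
proof (rule invertibleI_ker)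
  obtain m where m: "CARD('n) = Suc m" using zero_less_card_finite[where 'a = 'n] by (metis gr0_conv_Suc)
  fix x assume x: "companion r *v x = 0"
  have xS: "x $ at_pos (Suc k) = 0" if "Suc k < CARD('n)" for k
    using arg_cong[OF x, of "\<lambda>v. v $ at_pos k"] that by (simp add: companion_mult_nth)
  have "(\<Sum>k<CARD('n). r $ at_pos k * x $ at_pos k) = 0"
    using arg_cong[OF x, of "\<lambda>v. v $ at_pos m"] m by (simp add: companion_mult_nth sum_pos)
  moreover have "(\<Sum>k<m. r $ at_pos (Suc k) * x $ at_pos (Suc k)) = 0"
    using m by (intro sum.neutral) (simp add: xS)
  ultimately have "r $ at_pos 0 * x $ at_pos 0 = 0"
    unfolding m sum.lessThan_Suc_shift by simp
  moreover have "r $ at_pos 0 \<noteq> 0"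
    using lead_coeff_square const_A by (auto simp: poly_srs_param_nth)
  ultimately have x0: "x $ at_pos 0 = 0" by simp
  show "x = 0"
  proof (rule vec_eq_at_posI)
    fix k assume "k < CARD('n)"
    then show "x $ at_pos k = 0 $ at_pos k" using x0 xS by (cases k) simp_all
  qed
qed

lemma matrix_inv_poly_B:
  "matrix_inv (poly_B A) = poly_V A ** companion r ** matrix_inv (poly_V A)"
proof (rule matrix_inv_eqI)
  have "poly_B A ** (poly_V A ** companion r ** matrix_inv (poly_V A)) =
      poly_V A ** matrix_inv (companion r) ** (matrix_inv (poly_V A) ** poly_V A) ** companion r ** matrix_inv (poly_V A)"
    unfolding poly_B_def r by (simp only: matrix_mul_assoc)
  also have "\<dots> = poly_V A ** (matrix_inv (companion r) ** companion r) ** matrix_inv (poly_V A)"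
    by (simp only: invertible_matrix_inv(2)[OF invertible_poly_V] matrix_mul_rid) (simp only: matrix_mul_assoc)
  also have "\<dots> = mat 1"
    by (simp only: invertible_matrix_inv[OF invertible_companion] invertible_matrix_inv[OF invertible_poly_V] matrix_mul_rid)
  finally show "poly_B A ** (poly_V A ** companion r ** matrix_inv (poly_V A)) = mat 1" .
qed

text \<open>Here \<open>V^(-1)\<close> multiplies the first unit vector by a_d, and one factor
  \<open>M\<close> turns that vector into \<open>- (a_d / a_0) e_d\<close>; the two factors a_d
  cancel and the exponent drops from i + 1 to i.\<close>

lemma self_affine_tile_term:
  "mat_power (matrix_inv (poly_B A)) (Suc i) *v (\<chi> k :: 'n. if pos k = 0 then c else 0) =
     poly_V A *v ((- c / real_of_int (coeff A 0)) *\<^sub>R (mat_power (companion r) i *v last_unit))"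
proof -
  let ?V = "poly_V A :: real ^ 'n::{finite, linorder} ^ 'n::{finite, linorder}" and ?e = "\<lambda>c. (\<chi> k :: 'n. if pos k = 0 then c else 0) :: real ^ 'n::{finite, linorder}"
  let ?ad = "real_of_int (coeff A CARD('n))"
  have ad: "?ad * (?ad * c) = c"
    using lead_coeff_square by (metis mult.assoc mult_1 of_int_1 of_int_mult)
  have e: "matrix_inv ?V *v ?e c = ?e (?ad * c)"
  proof -
    have "matrix_inv ?V *v ?e c = matrix_inv ?V *v (?V *v ?e (?ad * c))"
      unfolding poly_V_mult_first_unit ad ..
    then show ?thesis
      unfolding matrix_vector_mul_assoc invertible_matrix_inv(2)[OF invertible_poly_V] by simp
  qed
  have "mat_power (matrix_inv (poly_B A)) (Suc i) *v ?e c = ?V *v (mat_power (companion r) i *v (companion r *v (matrix_inv ?V *v ?e c)))"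
    unfolding matrix_inv_poly_B mat_power_conjugate[OF invertible_matrix_inv(2)[OF invertible_poly_V]]
    by (simp only: mat_power_Suc_right matrix_vector_mul_assoc matrix_mul_assoc)
  also have "companion r *v (matrix_inv ?V *v ?e c) = (- c / real_of_int (coeff A 0)) *\<^sub>R last_unit"
    unfolding e companion_mult_first_unit using ad by (simp add: mult_ac)
  finally show ?thesis by (simp only: matrix_vector_mult_scaleR)
qed

text \<open>The linear homeomorphism \<open>V\<close> carries digit series to digit series term by
  term, so membership in the two tiles corresponds.\<close>

lemma srs_tile_eq_image_self_affine_tile:
  "srs_tile r 0 = (\<lambda>v. matrix_inv (poly_V A) *v v) ` self_affine_tile A"
proof -
  let ?V = "poly_V A :: real ^ 'n::{finite, linorder} ^ 'n::{finite, linorder}" and ?w = "\<lambda>j. mat_power (companion r) j *v last_unit"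
  have VV: "?V *v (matrix_inv ?V *v t) = t" "matrix_inv ?V *v (?V *v t) = t" for t
    unfolding matrix_vector_mul_assoc using invertible_matrix_inv[OF invertible_poly_V] by simp_all
  have sums_iff: "(\<lambda>j. ?V *v u j) sums t \<longleftrightarrow> u sums (matrix_inv ?V *v t)" for u t
  proof
    assume "(\<lambda>j. ?V *v u j) sums t"
    then have "(\<lambda>j. matrix_inv ?V *v (?V *v u j)) sums (matrix_inv ?V *v t)"
      by (rule bounded_linear.sums[OF matrix_vector_mul_bounded_linear])
    then show "u sums (matrix_inv ?V *v t)" by (simp add: VV)
  next
    assume "u sums (matrix_inv ?V *v t)"
    then have "(\<lambda>j. ?V *v u j) sums (?V *v (matrix_inv ?V *v t))"
      by (rule bounded_linear.sums[OF matrix_vector_mul_bounded_linear])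
    then show "(\<lambda>j. ?V *v u j) sums t" by (simp add: VV)
  qed
  have iff: "t \<in> self_affine_tile A \<longleftrightarrow> matrix_inv ?V *v t \<in> srs_tile r 0" for t
  proof
    assume "t \<in> self_affine_tile A"
    then obtain c :: "nat \<Rightarrow> int" where c: "\<forall>i\<ge>1. c i \<in> {0..coeff A 0 - 1}"
      "(\<lambda>i. ?V *v ((- real_of_int (c (Suc i)) / real_of_int (coeff A 0)) *\<^sub>R ?w i)) sums t"
      unfolding self_affine_tile_def self_affine_tile_term by blast
    have "\<forall>j. - real_of_int (c (Suc j)) / real_of_int (coeff A 0) \<in> uminus ` digits"
    proof
      fix j
      have "c (Suc j) \<in> {0..coeff A 0 - 1}" using c(1) by simp
      then have "real_of_int (c (Suc j)) / real_of_int (coeff A 0) \<in> digits" unfolding digits_def by (rule imageI)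
      then show "- real_of_int (c (Suc j)) / real_of_int (coeff A 0) \<in> uminus ` digits"
        unfolding minus_divide_left[symmetric] by (rule imageI)
    qed
    then show "matrix_inv ?V *v t \<in> srs_tile r 0"
      using c(2) unfolding sums_iff srs_tile_eq_digit_series
      by (intro CollectI exI[of _ "\<lambda>j. - real_of_int (c (Suc j)) / real_of_int (coeff A 0)"] conjI)
  next
    assume "matrix_inv ?V *v t \<in> srs_tile r 0"
    then obtain c where c: "\<forall>j. c j \<in> uminus ` digits" "(\<lambda>j. c j *\<^sub>R ?w j) sums (matrix_inv ?V *v t)"
      unfolding srs_tile_eq_digit_series by blast
    have "\<forall>j. \<exists>c'. c' \<in> {0..coeff A 0 - 1} \<and> c j = - real_of_int c' / real_of_int (coeff A 0)"
    proof
      fix j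
      show "\<exists>c'. c' \<in> {0..coeff A 0 - 1} \<and> c j = - real_of_int c' / real_of_int (coeff A 0)"
        using c(1)[rule_format, of j] unfolding digits_def by auto
    qed
    from choice[OF this] obtain c' where c': "\<And>j. c' j \<in> {0..coeff A 0 - 1}" "\<And>j. c j = - real_of_int (c' j) / real_of_int (coeff A 0)"
      by blast
    \<comment> \<open>Digits of the self-affine tile are numbered from 1, those of the series from
      0.\<close>
    define d where "d i = c' (i - 1)" for i
    have "(\<lambda>i. ?V *v ((- real_of_int (d (Suc i)) / real_of_int (coeff A 0)) *\<^sub>R ?w i)) sums t"
      unfolding sums_iff using c(2) by (simp add: d_def c'(2))
    moreover have "\<forall>i\<ge>1. d i \<in> {0..coeff A 0 - 1}" using c'(1) by (simp add: d_def)
    ultimately show "t \<in> self_affine_tile A"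
      unfolding self_affine_tile_def self_affine_tile_term by blast
  qed
  show ?thesis
  proof (intro equalityI subsetI)
    fix t assume t: "t \<in> srs_tile r 0"
    have "?V *v t \<in> self_affine_tile A" unfolding iff VV by (rule t)
    then show "t \<in> (\<lambda>v. matrix_inv (poly_V A) *v v) ` self_affine_tile A"
      by (rule rev_image_eqI) (simp add: VV)
  next
    fix t :: "real ^ 'n::{finite, linorder}"
    assume "t \<in> (\<lambda>v. matrix_inv (poly_V A) *v v) ` self_affine_tile A"
    then show "t \<in> srs_tile r 0" using iff by blast
  qed
qed

end

section \<open>Minimal polynomials and simple extensions of the rationals\<close>

text \<open>Evaluation as a ring homomorphism on rational polynomials, used at real and complex
  points alike.\<close>

definition rpoly :: "rat poly \<Rightarrow> 'a::field_char_0 \<Rightarrow> 'a" where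
  "rpoly g x = poly (map_poly of_rat g) x"

lemma rpoly_0 [simp]: "rpoly 0 x = 0"
  by (simp add: rpoly_def)

lemma rpoly_pCons [simp]: "rpoly (pCons a g) x = of_rat a + x * rpoly g x"
  by (simp add: rpoly_def map_poly_pCons)

lemma rpoly_1 [simp]: "rpoly 1 x = 1"
  by (simp add: rpoly_def)

lemma rpoly_add [simp]: "rpoly (g + h) x = rpoly g x + rpoly h x"
  by (induction g h rule: poly_induct2) (simp_all add: of_rat_add algebra_simps)

lemma rpoly_smult [simp]: "rpoly (smult c g) x = of_rat c * rpoly g x"
  by (induction g) (simp_all add: of_rat_mult algebra_simps)

lemma rpoly_mult [simp]: "rpoly (g * h) x = rpoly g x * rpoly h x"
  by (induction g) (simp_all add: algebra_simps)

lemma rpoly_minus [simp]: "rpoly (- g) x = - rpoly g x"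
  using rpoly_smult[of "-1" g x] by simp

lemma rpoly_diff [simp]: "rpoly (g - h) x = rpoly g x - rpoly h x"
  using rpoly_add[of g "- h" x] by simp

lemma rpoly_of_int: "rpoly (map_poly of_int g) x = poly (map_poly of_int g) x"
  by (simp add: rpoly_def map_poly_map_poly o_def)

text \<open>A non-zero annihilating polynomial of least degree, made monic, is irreducible: in a
  factorization one factor vanishes at \<open>x\<close> and hence takes up the whole degree.\<close>

lemma ex_irreducible_rpoly_eq_0:
  assumes "p \<noteq> 0" "rpoly p x = 0"
  obtains q where "lead_coeff q = 1" "irreducible q" "rpoly q x = 0"
proof -
  have "\<exists>q. q \<noteq> 0 \<and> rpoly q x = 0 \<and> (\<forall>h. h \<noteq> 0 \<and> rpoly h x = 0 \<longrightarrow> degree q \<le> degree h)"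
    using ex_has_least_nat[of "\<lambda>q. q \<noteq> 0 \<and> rpoly q x = 0" p degree] assms by blast
  then obtain q where q: "q \<noteq> 0" "rpoly q x = 0" "\<And>h. h \<noteq> 0 \<Longrightarrow> rpoly h x = 0 \<Longrightarrow> degree q \<le> degree h"
    by blast
  define m where "m = smult (inverse (lead_coeff q)) q"
  have m: "m \<noteq> 0" "rpoly m x = 0" "degree m = degree q" "lead_coeff m = 1"
    using q by (simp_all add: m_def)
  have "irreducible m"
  proof (rule irreducibleI)
    show "m \<noteq> 0" by (rule m)
    show "\<not> is_unit m"
    proof
      assume "is_unit m"
      then obtain c where "m = [:c:]" "c \<noteq> 0" using m(1) by (auto simp: is_unit_poly_iff)
      then show False using m(2) by simp
    qed
    fix a b assume ab: "m = a * b"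
    then have nz: "a \<noteq> 0" "b \<noteq> 0" using m(1) by auto
    then have deg: "degree q = degree a + degree b" using m(3) ab by (simp add: degree_mult_eq)
    have "rpoly a x = 0 \<or> rpoly b x = 0" using m(2) ab by simp
    then have "degree q \<le> degree a \<or> degree q \<le> degree b" using q(3) nz by blast
    then have "degree a = 0 \<or> degree b = 0" using deg by linarith
    then show "is_unit a \<or> is_unit b" using nz by (auto simp: is_unit_iff_degree)
  qed
  then show ?thesis using that m by blast
qed

text \<open>Bezout's identity for the coprime polynomials \<open>m\<close> and \<open>g\<close>,
  evaluated where \<open>m\<close> vanishes.\<close>

lemma rpoly_bezout:
  assumes m: "irreducible m" "rpoly m x = 0" and g: "\<not> m dvd g"
  obtains u where "rpoly u x * rpoly g x = 1"
proof -
  have "coprime m g" using m(1) g irreducible_imp_prime_elem_gcd prime_elem_imp_coprime by blast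
  then have "gcd m g = 1" by (rule coprime_imp_gcd_eq_1)
  moreover obtain a b where "a * m + b * g = gcd m g" using bezout_coefficients_fst_snd[of m g] by blast
  ultimately have "rpoly (a * m + b * g) x = 1" by simp
  then have "rpoly b x * rpoly g x = 1" by (simp add: m(2))
  then show ?thesis using that by blast
qed

lemma rpoly_eq_0_iff_dvd:
  assumes "irreducible m" "rpoly m x = 0"
  shows "rpoly g x = 0 \<longleftrightarrow> m dvd g"
proof
  assume g: "rpoly g x = 0"
  show "m dvd g"
  proof (rule ccontr)
    assume "\<not> m dvd g"
    then obtain u where "rpoly u x * rpoly g x = 1" using rpoly_bezout[OF assms] by blast
    then show False using g by simp
  qed
next
  assume "m dvd g"
  then show "rpoly g x = 0" using assms(2) by (auto elim!: dvdE)
qed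

text \<open>Two monic irreducible annihilators divide each other and hence agree, which justifies
  the definite description in \<open>min_poly\<close>.\<close>

lemma min_poly:
  assumes "algebraic_int x"
  shows "lead_coeff (min_poly x) = 1" "irreducible (min_poly x)" "rpoly (min_poly x) x = 0"
proof -
  obtain p :: "int poly" where p: "poly (map_poly of_int p) x = 0" "lead_coeff p = 1"
    using assms algebraic_int_altdef_ipoly by blast
  have "map_poly rat_of_int p \<noteq> 0"
  proof
    assume "map_poly rat_of_int p = 0"
    then have "coeff (map_poly rat_of_int p) (degree p) = 0" by simp
    then show False using p(2) by (simp add: coeff_map_poly)
  qed
  moreover have "rpoly (map_poly rat_of_int p) x = 0" using p(1) by (simp add: rpoly_of_int)
  ultimately obtain q where q: "lead_coeff q = 1" "irreducible q" "rpoly q x = 0"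
    by (rule ex_irreducible_rpoly_eq_0)
  have unique: "h = q" if h: "lead_coeff h = 1" "irreducible h" "rpoly h x = 0" for h
  proof -
    have "q dvd h" "h dvd q" using rpoly_eq_0_iff_dvd q h by blast+
    then obtain k where k: "h = q * k" by blast
    have nz: "q \<noteq> 0" "h \<noteq> 0" "k \<noteq> 0" using q(1) h(1) k by auto
    have "degree h \<le> degree q" using \<open>h dvd q\<close> nz(1) by (rule dvd_imp_degree_le)
    moreover have "degree h = degree q + degree k" unfolding k using nz by (intro degree_mult_eq)
    ultimately obtain a where a: "k = [:a:]" by (metis add_le_same_cancel1 degree_eq_zeroE le_zero_eq)
    have "lead_coeff h = lead_coeff q * a" unfolding k lead_coeff_mult a by simp
    then have "a = 1" using q(1) h(1) by (simp only: mult_1)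
    then show ?thesis using k a by simp
  qed
  have "\<exists>!q. lead_coeff q = 1 \<and> irreducible q \<and> poly (map_poly of_rat q) x = 0"
    using q unique unfolding rpoly_def by (intro ex1I[of _ q]) blast+
  from theI'[OF this] show "lead_coeff (min_poly x) = 1" "irreducible (min_poly x)" "rpoly (min_poly x) x = 0"
    unfolding min_poly_def rpoly_def by blast+
qed

section \<open>Gauss's lemma over the integers\<close>

lemma clear_denominators:
  fixes q :: "rat poly"
  obtains c Q where "c \<noteq> 0" "smult (rat_of_int c) q = map_poly rat_of_int Q"
proof -
  have "\<exists>c Q. c \<noteq> 0 \<and> smult (rat_of_int c) q = map_poly rat_of_int Q"
  proof (induction q)
    case 0
    show ?case by (intro exI[of _ 1] exI[of _ 0]) simp
  next
    case (pCons a q)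
    then obtain c Q where cQ: "c \<noteq> 0" "smult (rat_of_int c) q = map_poly rat_of_int Q" by blast
    obtain k n where a: "a = rat_of_int k / rat_of_int n" "n \<noteq> 0"
      by (cases a) (auto simp: Fract_of_int_quotient)
    have "smult (rat_of_int (c * n)) (pCons a q) = pCons (rat_of_int (c * k)) (smult (rat_of_int n) (smult (rat_of_int c) q))"
      using a by (simp add: mult.commute)
    also have "\<dots> = map_poly rat_of_int (pCons (c * k) (smult n Q))"
      unfolding cQ(2) by (simp add: map_poly_pCons map_poly_smult)
    finally show ?case using cQ(1) a(2) by (intro exI[of _ "c * n"] exI[of _ "pCons (c * k) (smult n Q)"]) simp
  qed
  then show ?thesis using that by blast
qed

lemma map_poly_of_int_mult:
  "map_poly (of_int :: int \<Rightarrow> 'a::{comm_ring_1, ring_char_0}) (p * q) = map_poly of_int p * map_poly of_int q"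
proof (rule poly_eqI)
  fix n show "coeff (map_poly (of_int :: int \<Rightarrow> 'a) (p * q)) n = coeff (map_poly of_int p * map_poly of_int q) n"
    by (simp add: coeff_map_poly coeff_mult)
qed

text \<open>After clearing denominators, \<open>smult (c * d) p = M * Q\<close> with
  \<open>p\<close> primitive. Multiplicativity of contents and comparison of leading coefficients
  force the primitive part of \<open>M\<close> to have leading coefficient 1 or -1; up to sign it is
  \<open>m\<close>.\<close>

lemma gauss_lemma_monic:
  fixes m q :: "rat poly" and p :: "int poly"
  assumes "m * q = map_poly of_int p" "lead_coeff p = 1" "lead_coeff m = 1"
  obtains m' where "m = map_poly rat_of_int m'"
proof -
  obtain c M where M: "c \<noteq> 0" "smult (rat_of_int c) m = map_poly rat_of_int M" by (rule clear_denominators)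
  obtain d Q where Q: "d \<noteq> 0" "smult (rat_of_int d) q = map_poly rat_of_int Q" by (rule clear_denominators)
  have inj: "P = P'" if "map_poly rat_of_int P = map_poly rat_of_int P'" for P P'
    using arg_cong[OF that, of "\<lambda>P. coeff P _"] by (intro poly_eqI) (simp add: coeff_map_poly)
  have "map_poly rat_of_int (smult (c * d) p) = smult (rat_of_int (c * d)) (m * q)"
    unfolding assms(1) by (simp add: map_poly_smult)
  also have "\<dots> = map_poly rat_of_int (M * Q)"
    unfolding map_poly_of_int_mult M(2)[symmetric] Q(2)[symmetric] by (simp add: mult.commute)
  finally have eq: "smult (c * d) p = M * Q" by (rule inj)
  have "content p dvd 1" using content_dvd_coeff[of p "degree p"] assms(2) by simp
  then have "content p = 1" by (metis normalize_content is_unit_normalize)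
  then have cont: "\<bar>c * d\<bar> = content M * content Q"
    using arg_cong[OF eq, of content] by (simp add: content_mult)
  define M1 where "M1 = primitive_part M"
  have M1: "M = smult (content M) M1" by (simp add: M1_def)
  have lead: "rat_of_int c = rat_of_int (lead_coeff M)"
    using arg_cong[OF M(2), of lead_coeff] assms(3) M(1) by (simp add: coeff_map_poly degree_map_poly)
  have leadM: "lead_coeff M = content M * lead_coeff M1"
    using arg_cong[OF M1, of lead_coeff] by (simp only: lead_coeff_smult)
  have leadQ: "lead_coeff Q = content Q * lead_coeff (primitive_part Q)"
    by (metis content_times_primitive_part lead_coeff_smult)
  have c: "c = content M * lead_coeff M1" using lead unfolding leadM by (simp only: of_int_eq_iff)
  have "c * d = lead_coeff M * lead_coeff Q"
    using arg_cong[OF eq, of lead_coeff] assms(2) by (simp only: lead_coeff_mult lead_coeff_smult mult_1_right)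
  also have "\<dots> = content M * lead_coeff M1 * (content Q * lead_coeff (primitive_part Q))"
    by (simp only: leadM leadQ)
  finally have cd: "c * d = content M * content Q * (lead_coeff M1 * lead_coeff (primitive_part Q))"
    by (simp only: mult_ac)
  have "\<bar>c * d\<bar> = \<bar>\<bar>c * d\<bar>\<bar> * \<bar>lead_coeff M1 * lead_coeff (primitive_part Q)\<bar>"
    using arg_cong[OF cd, of abs] unfolding cont[symmetric] abs_mult[of "\<bar>c * d\<bar>"] .
  then have "\<bar>lead_coeff M1 * lead_coeff (primitive_part Q)\<bar> = 1" using M(1) Q(1) by simp
  then have "\<bar>lead_coeff M1\<bar> = 1" by (metis abs_mult abs_zmult_eq_1 abs_abs)
  then have "lead_coeff M1 * lead_coeff M1 = 1" by (metis abs_mult_self_eq mult_1)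
  then have "c * lead_coeff M1 = content M" by (simp add: c mult.assoc)
  then have "M = smult c (smult (lead_coeff M1) M1)" using M1 by simp
  then have "smult (rat_of_int c) m = smult (rat_of_int c) (map_poly rat_of_int (smult (lead_coeff M1) M1))"
    unfolding M(2) by (simp only: map_poly_smult of_int_0 of_int_mult)
  then have "m = map_poly rat_of_int (smult (lead_coeff M1) M1)"
    using M(1) smult_eq_iff[of "rat_of_int c" "rat_of_int c"] by simp
  then show ?thesis by (rule that)
qed

section \<open>Simple extensions and their isomorphisms\<close>

lemma is_subfield_rat_adjoin: "is_subfield (rat_adjoin x)"
  unfolding is_subfield_def rat_adjoin_def by blast

lemma mem_rat_adjoin: "x \<in> rat_adjoin x"
  unfolding rat_adjoin_def by blast

lemma of_int_mem_subfield:
  assumes "is_subfield K"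
  shows "of_int k \<in> K"
proof -
  have nat: "of_nat n \<in> K" for n
    using assms by (induction n) (auto simp: is_subfield_def)
  show ?thesis
  proof (cases k rule: int_cases2)
    case (nonneg n)
    then show ?thesis using nat[of n] by simp
  next
    case (nonpos n)
    then show ?thesis using nat[of n] assms by (simp add: is_subfield_def)
  qed
qed

lemma of_rat_mem_subfield:
  assumes "is_subfield K"
  shows "of_rat q \<in> K"
proof (cases q)
  case (Fract a b)
  then have "of_rat q = of_int a * inverse (of_int b :: 'a)" by (simp add: of_rat_rat divide_inverse)
  then show ?thesis using of_int_mem_subfield[OF assms] assms by (simp add: is_subfield_def)
qed

lemma rpoly_mem_subfield:
  assumes "is_subfield K" "x \<in> K"
  shows "rpoly g x \<in> K"
  by (induction g) (use assms of_rat_mem_subfield[OF assms(1)] in \<open>auto simp: is_subfield_def\<close>)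

text \<open>The polynomial expressions in \<open>x\<close> are already closed under inverses, by
  Bezout.\<close>

lemma rat_adjoin_eq_range_rpoly:
  assumes m: "irreducible m" "rpoly m x = 0"
  shows "rat_adjoin x = range (\<lambda>g. rpoly g x)"
proof
  have inv: "\<exists>u. rpoly u x = inverse (rpoly g x)" for g
  proof (cases "rpoly g x = 0")
    \<comment> \<open>\<open>inverse 0 = 0\<close>, so the zero polynomial serves.\<close>
    case True
    then show ?thesis by (intro exI[of _ 0]) simp
  next
    case False
    then obtain u where "rpoly u x * rpoly g x = 1"
      using rpoly_bezout[OF m] rpoly_eq_0_iff_dvd[OF m] by blast
    then show ?thesis by (metis inverse_unique mult.commute)
  qed
  have "is_subfield (range (\<lambda>g. rpoly g x))"
    unfolding is_subfield_def
  proof (intro conjI ballI)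
    show "0 \<in> range (\<lambda>g. rpoly g x)" by (rule range_eqI[of _ _ 0]) simp
    show "1 \<in> range (\<lambda>g. rpoly g x)" by (rule range_eqI[of _ _ 1]) simp
    fix a assume "a \<in> range (\<lambda>g. rpoly g x)"
    then obtain g where g: "a = rpoly g x" by blast
    show "- a \<in> range (\<lambda>g. rpoly g x)" by (rule range_eqI[of _ _ "- g"]) (simp add: g)
    show "inverse a \<in> range (\<lambda>g. rpoly g x)" using inv[of g] unfolding g by (metis rangeI)
    fix b assume "b \<in> range (\<lambda>g. rpoly g x)"
    then obtain h where h: "b = rpoly h x" by blast
    show "a + b \<in> range (\<lambda>g. rpoly g x)" by (rule range_eqI[of _ _ "g + h"]) (simp add: g h)
    show "a * b \<in> range (\<lambda>g. rpoly g x)" by (rule range_eqI[of _ _ "g * h"]) (simp add: g h)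
  qed
  moreover have "x \<in> range (\<lambda>g. rpoly g x)" by (rule range_eqI[of _ _ "[:0, 1:]"]) simp
  ultimately show "rat_adjoin x \<subseteq> range (\<lambda>g. rpoly g x)" unfolding rat_adjoin_def by blast
  show "range (\<lambda>g. rpoly g x) \<subseteq> rat_adjoin x"
    using rpoly_mem_subfield[OF is_subfield_rat_adjoin mem_rat_adjoin] by blast
qed

text \<open>Evaluation at \<open>x\<close> and at \<open>y\<close> has the same kernel, the
  multiples of \<open>m\<close>; hence sending the value at \<open>x\<close> to the value at
  \<open>y\<close> is well defined and injective.\<close>

lemma field_iso_rat_adjoin:
  assumes m: "irreducible m" "rpoly m x = 0" "rpoly m y = 0"
  obtains \<sigma> where "field_iso \<sigma> (rat_adjoin x) (rat_adjoin y)" "\<And>g. \<sigma> (rpoly g x) = rpoly g y"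
proof -
  have eq_iff: "rpoly g x = rpoly h x \<longleftrightarrow> rpoly g y = rpoly h y" for g h
    using rpoly_eq_0_iff_dvd[OF m(1,2), of "g - h"] rpoly_eq_0_iff_dvd[OF m(1,3), of "g - h"] by simp
  define \<sigma> where "\<sigma> a = rpoly (SOME g. rpoly g x = a) y" for a
  have \<sigma>: "\<sigma> (rpoly g x) = rpoly g y" for g
  proof -
    have "rpoly (SOME h. rpoly h x = rpoly g x) x = rpoly g x" by (rule someI) simp
    then show ?thesis unfolding \<sigma>_def by (simp only: eq_iff)
  qed
  have "field_iso \<sigma> (rat_adjoin x) (rat_adjoin y)"
    unfolding field_iso_def rat_adjoin_eq_range_rpoly[OF m(1,2)] rat_adjoin_eq_range_rpoly[OF m(1,3)]
  proof (intro conjI ballI)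
    show "bij_betw \<sigma> (range (\<lambda>g. rpoly g x)) (range (\<lambda>g. rpoly g y))"
      by (rule bij_betwI') (auto simp: \<sigma> eq_iff)
    show "\<sigma> 1 = 1" using \<sigma>[of 1] by simp
    fix a b assume "a \<in> range (\<lambda>g. rpoly g x)" "b \<in> range (\<lambda>g. rpoly g x)"
    then obtain g h where gh: "a = rpoly g x" "b = rpoly h x" by blast
    show "\<sigma> (a + b) = \<sigma> a + \<sigma> b" using \<sigma>[of "g + h"] \<sigma>[of g] \<sigma>[of h] by (simp add: gh)
    show "\<sigma> (a * b) = \<sigma> a * \<sigma> b" using \<sigma>[of "g * h"] \<sigma>[of g] \<sigma>[of h] by (simp add: gh)
  qed
  then show ?thesis using \<sigma> that by blast
qed

text \<open>An isomorphism fixes 1 and hence all integers. Integer polynomials suffice, since only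
  elements of Z[\<beta>] get embedded below.\<close>

lemma field_iso_poly_of_int:
  fixes \<sigma> :: "'a::field_char_0 \<Rightarrow> 'b::field_char_0"
  assumes "field_iso \<sigma> (rat_adjoin x) L"
  shows "\<sigma> (poly (map_poly of_int g) x) = poly (map_poly of_int g) (\<sigma> x)"
proof -
  note K = is_subfield_rat_adjoin[of x]
  have mem: "poly (map_poly of_int g) x \<in> rat_adjoin x" for g
    using rpoly_mem_subfield[OF K mem_rat_adjoin, of "map_poly of_int g"] by (simp add: rpoly_of_int)
  have one: "\<sigma> 1 = 1" and add: "\<And>a b. a \<in> rat_adjoin x \<Longrightarrow> b \<in> rat_adjoin x \<Longrightarrow> \<sigma> (a + b) = \<sigma> a + \<sigma> b"
    and mult: "\<And>a b. a \<in> rat_adjoin x \<Longrightarrow> b \<in> rat_adjoin x \<Longrightarrow> \<sigma> (a * b) = \<sigma> a * \<sigma> b"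
    using assms unfolding field_iso_def by blast+
  have int_mem: "of_int k \<in> rat_adjoin x" for k by (rule of_int_mem_subfield[OF K])
  have zero: "\<sigma> 0 = 0" using add[of 0 0] K by (simp add: is_subfield_def)
  have nat: "\<sigma> (of_nat n) = of_nat n" for n
  proof (induction n)
    case 0
    show ?case by (simp add: zero)
  next
    case (Suc n)
    have "\<sigma> (of_int 1 + of_int (int n)) = \<sigma> (of_int 1) + \<sigma> (of_int (int n))"
      by (rule add) (rule int_mem)+
    then show ?case using Suc one by simp
  qed
  have int: "\<sigma> (of_int k) = of_int k" for k
  proof (cases k rule: int_cases2)
    case (nonneg n)
    then show ?thesis using nat[of n] by simp
  next
    case (nonpos n)
    have "\<sigma> (of_int k + of_int (int n)) = \<sigma> (of_int k) + \<sigma> (of_int (int n))"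
      by (rule add) (rule int_mem)+
    moreover have "of_int k + of_int (int n) = (0 :: 'a)" "of_int k + of_nat n = (0 :: 'b)"
      unfolding nonpos by simp_all
    ultimately have "\<sigma> (of_int k) + of_nat n = of_int k + of_nat n" using nat[of n] zero by simp
    then show ?thesis by simp
  qed
  show ?thesis
  proof (induction g)
    case 0
    show ?case by (simp add: zero)
  next
    case (pCons a g)
    have "x * poly (map_poly of_int g) x \<in> rat_adjoin x"
      using K mem[of g] mem_rat_adjoin[of x] by (simp add: is_subfield_def)
    then have "\<sigma> (of_int a + x * poly (map_poly of_int g) x) = of_int a + \<sigma> x * \<sigma> (poly (map_poly of_int g) x)"
      using add int_mem int mult mem mem_rat_adjoin by metis
    then show ?case using pCons by (simp add: map_poly_pCons)
  qed
qed

text \<open>\<open>field_iso_rat_adjoin\<close> provides an isomorphism and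
  \<open>field_iso_poly_of_int\<close> the uniqueness of its value, as the definite description in
  \<open>conj_image\<close> requires.\<close>

lemma conj_image_poly_of_int:
  assumes m: "irreducible m" "rpoly m \<beta> = 0" "rpoly m z = 0"
  shows "conj_image \<beta> z (poly (map_poly of_int g) \<beta>) = poly (map_poly of_int g) z"
proof -
  obtain \<sigma> where \<sigma>: "field_iso \<sigma> (rat_adjoin \<beta>) (rat_adjoin z)" "\<And>g. \<sigma> (rpoly g \<beta>) = rpoly g z"
    using field_iso_rat_adjoin[OF m] by blast
  have \<sigma>\<beta>: "\<sigma> \<beta> = z" using \<sigma>(2)[of "[:0, 1:]"] by simp
  show ?thesis
    unfolding conj_image_def
  proof (rule the_equality)
    show "\<exists>\<sigma>. field_iso \<sigma> (rat_adjoin \<beta>) (rat_adjoin z) \<and> \<sigma> \<beta> = z \<and>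
        poly (map_poly of_int g) z = \<sigma> (poly (map_poly of_int g) \<beta>)"
      using \<sigma>(1) \<sigma>\<beta> field_iso_poly_of_int[OF \<sigma>(1), of g] by (intro exI[of _ \<sigma>]) simp
    fix y assume "\<exists>\<sigma>. field_iso \<sigma> (rat_adjoin \<beta>) (rat_adjoin z) \<and> \<sigma> \<beta> = z \<and> y = \<sigma> (poly (map_poly of_int g) \<beta>)"
    then show "y = poly (map_poly of_int g) z" using field_iso_poly_of_int by metis
  qed
qed

lemma min_poly_of_int:
  assumes "algebraic_int x"
  obtains m where "min_poly x = map_poly rat_of_int m"
proof -
  obtain p :: "int poly" where p: "poly (map_poly of_int p) x = 0" "lead_coeff p = 1"
    using assms algebraic_int_altdef_ipoly by blast
  have "rpoly (map_poly rat_of_int p) x = 0" using p(1) by (simp add: rpoly_of_int)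
  then have "min_poly x dvd map_poly rat_of_int p"
    using rpoly_eq_0_iff_dvd[OF min_poly(2,3)[OF assms]] by blast
  then obtain q where "min_poly x * q = map_poly rat_of_int p" by (metis dvdE)
  then show ?thesis using gauss_lemma_monic p(2) min_poly(1)[OF assms] that by blast
qed

section \<open>Tails of polynomials\<close>

text \<open>One Horner step: \<open>poly_shift i\<close> drops the lowest i coefficients.\<close>

lemma poly_poly_shift: "poly (poly_shift i c) x = coeff c i + x * poly (poly_shift (Suc i) c) x"
proof -
  have "poly_shift i c = pCons (coeff c i) (poly_shift (Suc i) c)"
    by (rule poly_eqI) (simp add: coeff_poly_shift coeff_pCons split: nat.split)
  then show ?thesis by simp
qed

lemma poly_shift_eq_0: "degree c < i \<Longrightarrow> poly_shift i c = 0"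
  by (rule poly_eqI) (simp add: coeff_poly_shift coeff_eq_0)

lemma poly_shift_linear_mult:
  fixes c :: "'a::comm_ring_1 poly"
  shows "poly_shift (Suc i) ([:- b, 1:] * c) = poly_shift i c - smult b (poly_shift (Suc i) c)"
  by (rule poly_eqI) (simp add: coeff_poly_shift)

text \<open>Horner tails of \<open>c\<close> weighted by \<open>v\<close>. For the minimal
  polynomial the tails at \<beta> are r_0, ..., r_(d-1), 1; for the characteristic polynomial the
  tails at a root are the entries of a left eigenvector.\<close>

definition tail_comb :: "'a::comm_ring_1 poly \<Rightarrow> (nat \<Rightarrow> 'a) \<Rightarrow> 'a poly" where
  "tail_comb c v = (\<Sum>i<degree c. smult (v i) (poly_shift (Suc i) c))"

lemma coeff_tail_comb: "coeff (tail_comb c v) k = (\<Sum>i<degree c. v i * coeff c (k + Suc i))"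
  by (simp add: tail_comb_def coeff_sum coeff_poly_shift)

lemma degree_tail_comb: "degree c > 0 \<Longrightarrow> degree (tail_comb c v) < degree c"
proof -
  assume pos: "degree c > 0"
  have "degree (tail_comb c v) \<le> degree c - 1"
    by (rule degree_le) (auto simp: coeff_tail_comb coeff_eq_0 intro!: sum.neutral)
  then show ?thesis using pos by simp
qed

text \<open>The matrix of \<open>v \<mapsto> tail_comb c v\<close> in the monomial basis is unitriangular after reversing the coefficients.\<close>

lemma tail_comb_eq_0D:
  assumes "lead_coeff c = 1" "tail_comb c v = 0" "i < degree c"
  shows "v i = 0"
  using assms(3)
proof (induction i rule: less_induct)
  case (less i)
  have "0 = coeff (tail_comb c v) (degree c - Suc i)" using assms(2) by simp
  also have "\<dots> = (\<Sum>j<degree c. v j * coeff c (degree c - Suc i + Suc j))" by (rule coeff_tail_comb)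
  also have "\<dots> = (\<Sum>j<degree c. if j = i then v i else 0)"
  proof (intro sum.cong refl)
    fix j assume j: "j \<in> {..<degree c}"
    consider "j < i" | "j = i" | "j > i" by linarith
    then show "v j * coeff c (degree c - Suc i + Suc j) = (if j = i then v i else 0)"
    proof cases
      case 1
      then show ?thesis using less j by simp
    next
      case 2
      have "degree c - Suc i + Suc i = degree c" using less.prems by linarith
      then show ?thesis using 2 assms(1) by (simp only: mult_1_right simp_thms if_True)
    next
      case 3
      then have "degree c < degree c - Suc i + Suc j" using less.prems by linarith
      then show ?thesis using 3 by (simp add: coeff_eq_0)
    qed
  qed
  also have "\<dots> = v i" using less.prems by simp
  finally show ?case by simp
qed

lemma poly_eq_0_if_many_roots:
  fixes q :: "'a::idom poly"
  assumes "finite S" "\<And>x. x \<in> S \<Longrightarrow> poly q x = 0" "degree q < card S"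
  shows "q = 0"
proof (rule ccontr)
  assume q: "q \<noteq> 0"
  have "card S \<le> card {x. poly q x = 0}"
    using assms(2) by (intro card_mono poly_roots_finite[OF q]) blast
  also have "\<dots> \<le> degree q" by (rule card_poly_roots_bound[OF q])
  finally show False using assms(3) by simp
qed

section \<open>Left eigenvectors of companion matrices\<close>

definition companion_poly_complex :: "real ^ 'n::{finite, linorder} \<Rightarrow> complex poly" where
  "companion_poly_complex r = map_poly of_real (companion_poly r)"

lemma coeff_companion_poly_complex:
  "coeff (companion_poly_complex r) k = of_real (coeff (companion_poly r) k)"
  by (simp add: companion_poly_complex_def coeff_map_poly)

lemma degree_companion_poly_complex [simp]:
  "degree (companion_poly_complex (r :: real ^ 'n::{finite, linorder})) = CARD('n)"
  by (simp add: companion_poly_complex_def degree_map_poly)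

lemma lead_coeff_companion_poly_complex:
  "lead_coeff (companion_poly_complex (r :: real ^ 'n::{finite, linorder})) = 1"
  by (simp add: coeff_companion_poly_complex coeff_companion_poly)

lemma poly_shift_card_companion_poly:
  "poly (poly_shift CARD('n) (companion_poly_complex (r :: real ^ 'n::{finite, linorder}))) x = 1"
  by (subst poly_poly_shift) (simp add: poly_shift_eq_0 coeff_companion_poly_complex coeff_companion_poly)

text \<open>For a root \<open>x\<close> of the characteristic polynomial this pairs \<open>v\<close>
  with a left eigenvector of the companion matrix.\<close>

definition left_eig :: "real ^ 'n::{finite, linorder} \<Rightarrow> complex \<Rightarrow> real ^ 'n::{finite, linorder} \<Rightarrow> complex" where
  "left_eig r x v = (\<Sum>i<CARD('n). of_real (v $ at_pos i) * poly (poly_shift (Suc i) (companion_poly_complex r)) x)"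

lemma left_eig_add: "left_eig r x (v + w) = left_eig r x v + left_eig r x w"
  by (simp add: left_eig_def sum.distrib algebra_simps)

lemma left_eig_scaleR: "left_eig r x (c *\<^sub>R v) = of_real c * left_eig r x v"
  by (simp add: left_eig_def sum_distrib_left algebra_simps)

lemma left_eig_diff: "left_eig r x (v - w) = left_eig r x v - left_eig r x w"
  by (simp add: left_eig_def sum_subtractf algebra_simps)

lemma cnj_left_eig: "cnj (left_eig r x v) = left_eig r (cnj x) v"
proof -
  have "cnj (poly (poly_shift k (companion_poly_complex r)) x) = poly (poly_shift k (companion_poly_complex r)) (cnj x)" for k
    by (rule poly_cnj_real) (simp add: coeff_poly_shift coeff_companion_poly_complex)
  then show ?thesis unfolding left_eig_def cnj_sum complex_cnj_mult complex_cnj_complex_of_real by simp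
qed

lemma left_eig_eq_poly_tail_comb:
  fixes r v :: "real ^ 'n::{finite, linorder}"
  shows "left_eig r x v = poly (tail_comb (companion_poly_complex r) (\<lambda>i. of_real (v $ at_pos i))) x"
  by (simp add: left_eig_def tail_comb_def poly_sum)

text \<open>The tails satisfy \<open>t_i = r_i + x t_(i+1)\<close>, \<open>t_0 = 0\<close> and
  \<open>t_d = 1\<close>. Multiplying by \<open>x\<close> therefore shifts the weights by one place
  and leaves the term \<open>- r v\<close> of the last row.\<close>

lemma left_eig_companion:
  fixes r v :: "real ^ 'n::{finite, linorder}"
  assumes "poly (companion_poly_complex r) x = 0"
  shows "left_eig r x (companion r *v v) = x * left_eig r x v"
proof -
  let ?t = "\<lambda>i. poly (poly_shift i (companion_poly_complex r)) x"
  let ?S = "\<Sum>j<CARD('n). r $ at_pos j * v $ at_pos j"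
  obtain m where m: "CARD('n) = Suc m" using zero_less_card_finite[where 'a = 'n] by (metis gr0_conv_Suc)
  have t0: "?t 0 = 0" using assms by simp
  have last: "?t (Suc m) = 1" using poly_shift_card_companion_poly[of r x] m by simp
  have "x * left_eig r x v = (\<Sum>i<CARD('n). of_real (v $ at_pos i) * ?t i) - of_real ?S"
    unfolding left_eig_def sum_distrib_left of_real_sum sum_subtractf[symmetric]
  proof (intro sum.cong refl)
    fix i assume "i \<in> {..<CARD('n)}"
    then have "?t i = of_real (r $ at_pos i) + x * ?t (Suc i)"
      by (subst poly_poly_shift) (simp add: coeff_companion_poly_complex coeff_companion_poly)
    then show "x * (of_real (v $ at_pos i) * ?t (Suc i)) = of_real (v $ at_pos i) * ?t i - of_real (r $ at_pos i * v $ at_pos i)"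
      by (simp add: algebra_simps)
  qed
  also have "(\<Sum>i<CARD('n). of_real (v $ at_pos i) * ?t i) = (\<Sum>i<m. of_real (v $ at_pos (Suc i)) * ?t (Suc i))"
    unfolding m sum.lessThan_Suc_shift t0 by simp
  also have "(\<Sum>i<m. of_real (v $ at_pos (Suc i)) * ?t (Suc i)) = (\<Sum>i<m. of_real ((companion r *v v) $ at_pos i) * ?t (Suc i))"
    using m by (intro sum.cong) (simp_all add: companion_mult_nth)
  also have "of_real ?S = - of_real ((companion r *v v) $ at_pos m) * ?t (Suc m)"
    unfolding last using m by (simp add: companion_mult_nth sum_pos)
  finally show ?thesis unfolding left_eig_def m by simp
qed

lemma left_eig_mat_power:
  assumes "poly (companion_poly_complex r) x = 0"
  shows "left_eig r x (mat_power (companion r) n *v v) = x ^ n * left_eig r x v"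
  by (induction n) (simp_all add: mat_power_Suc matrix_vector_mul_assoc[symmetric] left_eig_companion[OF assms] mult.assoc)

text \<open>For fixed \<open>v\<close> the expression is a polynomial in \<open>x\<close> of degree
  below d, so d distinct zeros annihilate it, and unitriangularity returns
  \<open>v = 0\<close>.\<close>

lemma left_eig_eq_0D:
  fixes r v :: "real ^ 'n::{finite, linorder}"
  assumes "finite S" "CARD('n) \<le> card S" "\<And>x. x \<in> S \<Longrightarrow> left_eig r x v = 0"
  shows "v = 0"
proof -
  have "degree (tail_comb (companion_poly_complex r) (\<lambda>i. of_real (v $ at_pos i))) < card S"
    using degree_tail_comb[of "companion_poly_complex r" "\<lambda>i. of_real (v $ at_pos i)"] assms(2) by simp
  then have "tail_comb (companion_poly_complex r) (\<lambda>i. of_real (v $ at_pos i)) = 0"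
    using assms(1,3) by (intro poly_eq_0_if_many_roots[of S]) (simp_all add: left_eig_eq_poly_tail_comb)
  then have "complex_of_real (v $ at_pos i) = 0" if "i < CARD('n)" for i
    using tail_comb_eq_0D[OF lead_coeff_companion_poly_complex[of r], of "\<lambda>i. of_real (v $ at_pos i)" i] that by simp
  then show ?thesis by (intro vec_eq_at_posI) simp
qed

section \<open>Packing conjugates into real coordinates\<close>

text \<open>The layout of \<open>beta_embed\<close> with an arbitrary function of the conjugate, so
  that the embedding can be split into a linear part and an error term.\<close>

definition pack :: "nat \<Rightarrow> (nat \<Rightarrow> complex) \<Rightarrow> (complex \<Rightarrow> complex) \<Rightarrow> real ^ 'n::{finite, linorder}" where
  "pack p b f =
     (\<chi> i. if pos i < p then Re (f (b (pos i + 1)))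
           else let m = (pos i - p) div 2; y = f (b (p + m + 1))
                in if even (pos i - p) then Re y else Im y)"

lemma beta_embed_eq_pack: "beta_embed \<beta> p b x = pack p b (\<lambda>z. conj_image \<beta> z x)"
  by (simp add: beta_embed_def pack_def)

text \<open>The part taken and the conjugate used depend on the coordinate but not on
  \<open>f\<close>; identities then reduce to single coordinates.\<close>

lemma pack_nth:
  obtains h j where "h \<in> {Re, Im}" "j \<in> {1..CARD('n)}" "\<And>f. (pack p b f :: real ^ 'n::{finite, linorder}) $ i = h (f (b j))"
proof (cases "pos i < p")
  case True
  show ?thesis
    by (rule that[of Re "pos i + 1"]) (use True Suc_leI[OF pos_less_card[of i]] in \<open>auto simp: pack_def\<close>)
next
  case False
  have "p + (pos i - p) div 2 + 1 \<le> CARD('n)" using False pos_less_card[of i] by linarith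
  then show ?thesis
    by (intro that[of "if even (pos i - p) then Re else Im" "p + (pos i - p) div 2 + 1"])
      (use False in \<open>auto simp: pack_def Let_def\<close>)
qed

lemma pack_add: "pack p b (\<lambda>x. f x + g x) = (pack p b f + pack p b g :: real ^ 'n::{finite, linorder})"
  unfolding vec_eq_iff
proof
  fix i :: 'n
  obtain h j where h: "h \<in> {Re, Im}" "j \<in> {1..CARD('n)}" "\<And>f. (pack p b f :: real ^ 'n::{finite, linorder}) $ i = h (f (b j))"
    by (rule pack_nth[where p = p and b = b and i = i]) blast
  then show "(pack p b (\<lambda>x. f x + g x) :: real ^ 'n::{finite, linorder}) $ i = (pack p b f + pack p b g) $ i" using h by auto
qed

lemma pack_scaleR: "pack p b (\<lambda>x. of_real c * f x) = (c *\<^sub>R pack p b f :: real ^ 'n::{finite, linorder})"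
  unfolding vec_eq_iff
proof
  fix i :: 'n
  obtain h j where h: "h \<in> {Re, Im}" "j \<in> {1..CARD('n)}" "\<And>f. (pack p b f :: real ^ 'n::{finite, linorder}) $ i = h (f (b j))"
    by (rule pack_nth[where p = p and b = b and i = i]) blast
  then show "(pack p b (\<lambda>x. of_real c * f x) :: real ^ 'n::{finite, linorder}) $ i = (c *\<^sub>R pack p b f) $ i" using h by auto
qed

lemma pack_cong:
  assumes "\<And>j. j \<in> {1..CARD('n)} \<Longrightarrow> f (b j) = g (b j)"
  shows "(pack p b f :: real ^ 'n::{finite, linorder}) = pack p b g"
  unfolding vec_eq_iff
proof
  fix i :: 'n
  obtain h j where h: "h \<in> {Re, Im}" "j \<in> {1..CARD('n)}" "\<And>f. (pack p b f :: real ^ 'n::{finite, linorder}) $ i = h (f (b j))"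
    by (rule pack_nth[where p = p and b = b and i = i]) blast
  then show "(pack p b f :: real ^ 'n::{finite, linorder}) $ i = pack p b g $ i" using assms h by simp
qed

lemma norm_pack_le:
  assumes "\<And>j. j \<in> {1..CARD('n)} \<Longrightarrow> cmod (f (b j)) \<le> C"
  shows "norm (pack p b f :: real ^ 'n::{finite, linorder}) \<le> real CARD('n) * C"
proof -
  have "norm (pack p b f :: real ^ 'n::{finite, linorder}) \<le> (\<Sum>i\<in>UNIV. \<bar>(pack p b f :: real ^ 'n::{finite, linorder}) $ i\<bar>)" by (rule norm_le_l1_cart)
  also have "\<dots> \<le> (\<Sum>i\<in>(UNIV :: 'n set). C)"
  proof (rule sum_mono)
    fix i :: 'n
    obtain h j where h: "h \<in> {Re, Im}" "j \<in> {1..CARD('n)}" "\<And>f. (pack p b f :: real ^ 'n::{finite, linorder}) $ i = h (f (b j))"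
    by (rule pack_nth[where p = p and b = b and i = i]) blast
    have "\<bar>h (f (b j))\<bar> \<le> cmod (f (b j))" using h(1) abs_Re_le_cmod abs_Im_le_cmod by auto
    also have "\<dots> \<le> C" by (rule assms[OF h(2)])
    finally show "\<bar>(pack p b f :: real ^ 'n::{finite, linorder}) $ i\<bar> \<le> C" by (simp add: h(3))
  qed
  finally show ?thesis by simp
qed

text \<open>Only one member of each non-real pair is recorded, and only the real part at real
  conjugates; symmetry under conjugation and reality of \<open>f\<close> there supply the
  rest.\<close>

lemma pack_eq_0D:
  assumes eq: "(pack p b f :: real ^ 'n::{finite, linorder}) = 0" and d: "CARD('n) = p + 2 * s"
    and real: "\<And>j. j \<in> {1..p} \<Longrightarrow> f (b j) \<in> \<real>"
    and cnj: "\<And>j. j \<in> {1..s} \<Longrightarrow> f (b (p + s + j)) = cnj (f (b (p + j)))"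
    and j: "j \<in> {1..CARD('n)}"
  shows "f (b j) = 0"
proof -
  have mid: "f (b (p + k)) = 0" if k: "k \<in> {1..s}" for k
  proof -
    obtain m where m: "k = Suc m" using k by (cases k) auto
    have "(pack p b f :: real ^ 'n::{finite, linorder}) $ at_pos (p + 2 * m) = 0" "(pack p b f :: real ^ 'n::{finite, linorder}) $ at_pos (p + 2 * m + 1) = 0"
      using eq by simp_all
    then have "Re (f (b (p + m + 1))) = 0" "Im (f (b (p + m + 1))) = 0"
      using k m d by (simp_all add: pack_def Let_def)
    then show ?thesis using m by (simp add: complex_eq_iff)
  qed
  consider "j \<in> {1..p}" | k where "j = p + k" "k \<in> {1..s}" | k where "j = p + s + k" "k \<in> {1..s}"
  proof -
    consider "j \<le> p" | "p < j" "j \<le> p + s" | "p + s < j" by linarith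
    then show ?thesis
    proof cases
      case 1
      then show ?thesis using that(1) j by simp
    next
      case 2
      then show ?thesis using that(2)[of "j - p"] by (simp add: Suc_le_eq)
    next
      case 3
      then show ?thesis using that(3)[of "j - (p + s)"] j d by (simp add: Suc_le_eq)
    qed
  qed
  then show ?thesis
  proof cases
    case 1
    obtain k where k: "j = Suc k" "k < p" "k < CARD('n)" using 1 j by (cases j) auto
    have "(pack p b f :: real ^ 'n::{finite, linorder}) $ at_pos k = 0" using eq by simp
    then have "Re (f (b j)) = 0" using k by (simp add: pack_def)
    then show ?thesis using real[OF 1] by (auto elim!: Reals_cases)
  next
    case 2
    then show ?thesis using mid by simp
  next
    case 3
    then show ?thesis using mid cnj by simp
  qed
qed

section \<open>Unit Pisot numbers\<close>

lemma map_poly_of_int_tail_comb: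
  "map_poly (of_int :: int \<Rightarrow> 'a::{comm_ring_1, ring_char_0}) (tail_comb c v) =
     tail_comb (map_poly of_int c) (\<lambda>i. of_int (v i))"
  by (rule poly_eqI) (simp add: coeff_tail_comb coeff_map_poly degree_map_poly)

text \<open>Appends the next coordinate \<open>- \<lfloor>r z\<rfloor>\<close> at position d. Then
  \<open>srs_map\<close> is a plain shift, and pairing with the monic characteristic polynomial
  gives \<open>{r z}\<close>.\<close>

definition srs_ext :: "real ^ 'n::{finite, linorder} \<Rightarrow> int ^ 'n::{finite, linorder} \<Rightarrow> nat \<Rightarrow> int" where
  "srs_ext r z i = (if i < CARD('n) then z $ at_pos i else - \<lfloor>srs_dot r z\<rfloor>)"

lemma srs_map_nth_eq_srs_ext:
  fixes z :: "int ^ 'n::{finite, linorder}"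
  assumes "i < CARD('n)"
  shows "srs_map r z $ at_pos i = srs_ext r z (Suc i)"
proof (cases "Suc i < CARD('n)")
  case True
  then show ?thesis by (simp add: srs_ext_def srs_map_nth_Suc)
next
  case False
  then have "Suc i = CARD('n)" using assms by simp
  then show ?thesis by (simp add: srs_ext_def srs_map_nth_last)
qed

lemma srs_dot_eq_sum_coeff:
  fixes r :: "real ^ 'n::{finite, linorder}"
  shows "srs_dot r z = (\<Sum>i<CARD('n). coeff (companion_poly r) i * real_of_int (z $ at_pos i))"
  unfolding srs_dot_def sum_pos by (intro sum.cong) (simp_all add: coeff_companion_poly)

lemma frac_srs_dot_eq_sum:
  fixes r :: "real ^ 'n::{finite, linorder}"
  shows "frac (srs_dot r z) = (\<Sum>i<Suc CARD('n). coeff (companion_poly r) i * real_of_int (srs_ext r z i))"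
proof -
  have "(\<Sum>i<CARD('n). coeff (companion_poly r) i * real_of_int (srs_ext r z i)) = srs_dot r z"
    unfolding srs_dot_eq_sum_coeff by (intro sum.cong) (simp_all add: srs_ext_def)
  then show ?thesis by (simp add: coeff_companion_poly srs_ext_def frac_def)
qed

lemma beta_map_eq_frac: "beta_map \<beta> x = frac (\<beta> * x)"
  by (simp add: beta_map_def frac_def)

context
  fixes \<beta> :: real and r :: "real ^ 'n::{finite, linorder}" and p s :: nat and b :: "nat \<Rightarrow> complex"
    and m :: "int poly"
  assumes unit: "unit_pisot \<beta>" and degree_m: "degree m = Suc CARD('n)"
    and min_poly_eq: "min_poly \<beta> = map_poly rat_of_int m"
    and factor: "map_poly of_rat (min_poly \<beta>) = [:- \<beta>, 1:] * companion_poly r"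
    and ordering: "conj_ordering CARD('n) \<beta> p s b"
begin

lemma algebraic_int_beta: "algebraic_int \<beta>" and beta_gt_1: "\<beta> > 1"
  using unit by (simp_all add: unit_pisot_def pisot_def)

lemma lead_coeff_m: "lead_coeff m = 1"
  using min_poly(1)[OF algebraic_int_beta] unfolding min_poly_eq by (simp add: coeff_map_poly degree_map_poly)

lemma coeff_m_0_square: "coeff m 0 * coeff m 0 = 1"
proof -
  have "rat_of_int (coeff m 0) \<in> {1, - 1}"
    using unit by (simp add: unit_pisot_def min_poly_eq coeff_map_poly)
  then have "rat_of_int (coeff m 0 * coeff m 0) = 1" by auto
  then show ?thesis by (simp only: of_int_eq_1_iff)
qed

lemma map_poly_m_real: "map_poly real_of_int m = [:- \<beta>, 1:] * companion_poly r"
  unfolding factor[symmetric] min_poly_eq by (simp add: map_poly_map_poly o_def)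

lemma coeff_m_0: "real_of_int (coeff m 0) = - \<beta> * coeff (companion_poly r) 0"
  using arg_cong[OF map_poly_m_real, of "\<lambda>q. coeff q 0"] by (simp add: coeff_map_poly)

text \<open>Modulo the integers, multiplication by \<beta> moves a coefficient of
  \<open>companion_poly r\<close> to the preceding one.\<close>

lemma coeff_m_Suc:
  "real_of_int (coeff m (Suc i)) = coeff (companion_poly r) i - \<beta> * coeff (companion_poly r) (Suc i)"
  using arg_cong[OF map_poly_m_real, of "\<lambda>q. coeff q (Suc i)"] by (simp add: coeff_map_poly)

lemma map_poly_m_complex: "map_poly complex_of_int m = [:- of_real \<beta>, 1:] * companion_poly_complex r"
proof (rule poly_eqI)
  fix i
  have "complex_of_real (real_of_int (coeff m i)) = coeff ([:- of_real \<beta>, 1:] * companion_poly_complex r) i"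
    by (cases i) (simp_all only: coeff_m_0 coeff_m_Suc, simp_all add: coeff_companion_poly_complex)
  then show "coeff (map_poly complex_of_int m) i = coeff ([:- of_real \<beta>, 1:] * companion_poly_complex r) i"
    by (simp add: coeff_map_poly)
qed

lemma galois_conjugates_eq: "galois_conjugates \<beta> = {z. rpoly (min_poly \<beta>) z = 0}"
  by (simp add: galois_conjugates_def rpoly_def)

lemma conjugate:
  assumes "j \<in> {1..CARD('n)}"
  shows "rpoly (min_poly \<beta>) (b j) = 0" "b j \<noteq> of_real \<beta>" "cmod (b j) < 1"
    "poly (companion_poly_complex r) (b j) = 0"
proof -
  have *: "b j \<in> galois_conjugates \<beta> - {of_real \<beta>}"
    using ordering assms unfolding conj_ordering_def by (meson bij_betwE)
  then show 1: "rpoly (min_poly \<beta>) (b j) = 0" "b j \<noteq> of_real \<beta>" by (simp_all add: galois_conjugates_eq)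
  show "cmod (b j) < 1" using unit * by (simp add: unit_pisot_def pisot_def)
  have "poly (map_poly complex_of_int m) (b j) = 0"
    using 1(1) unfolding min_poly_eq rpoly_of_int .
  then show "poly (companion_poly_complex r) (b j) = 0" using 1(2) unfolding map_poly_m_complex by simp
qed

text \<open>An integer polynomial with value \<open>{r z}\<close> at \<beta>; it makes the
  conjugates of that number computable.\<close>

definition srs_poly :: "int ^ 'n::{finite, linorder} \<Rightarrow> int poly" where
  "srs_poly z = tail_comb m (srs_ext r z)"

text \<open>With \<open>R\<close> for the characteristic polynomial, a tail of
  \<open>(X - \<beta>) R\<close> at \<beta> combines two successive tails of \<open>R\<close>, which
  by Horner differ by a single coefficient.\<close>

lemma poly_shift_m_beta: "poly (poly_shift (Suc i) (map_poly real_of_int m)) \<beta> = coeff (companion_poly r) i"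
  unfolding map_poly_m_real poly_shift_linear_mult using poly_poly_shift[of i "companion_poly r" \<beta>] by simp

lemma poly_srs_poly_beta: "poly (map_poly of_int (srs_poly z)) \<beta> = frac (srs_dot r z)"
  unfolding srs_poly_def map_poly_of_int_tail_comb frac_srs_dot_eq_sum
  by (simp add: tail_comb_def degree_map_poly degree_m poly_sum poly_shift_m_beta mult.commute)

text \<open>Away from \<beta> the Horner cancellation leaves \<open>x - \<beta>\<close> times a tail
  of the characteristic polynomial; these tails add up to \<open>left_eig\<close>, the one past the
  leading coefficient being 0.\<close>

lemma poly_srs_poly_complex:
  "poly (map_poly of_int (srs_poly z)) x = (x - of_real \<beta>) * left_eig r x (int_vec z) + of_real (frac (srs_dot r z))"
proof -
  let ?t = "\<lambda>i. poly (poly_shift (Suc i) (companion_poly_complex r)) x"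
  have "poly (map_poly of_int (srs_poly z)) x = (\<Sum>i<Suc CARD('n). of_int (srs_ext r z i) *
      poly (poly_shift (Suc i) (map_poly of_int m)) x)"
    unfolding srs_poly_def map_poly_of_int_tail_comb by (simp add: tail_comb_def degree_map_poly degree_m poly_sum)
  also have "\<dots> = (\<Sum>i<Suc CARD('n). of_real (coeff (companion_poly r) i * real_of_int (srs_ext r z i))
      + (x - of_real \<beta>) * (of_int (srs_ext r z i) * ?t i))"
  proof (intro sum.cong refl)
    fix i
    have eq: "poly (poly_shift (Suc i) (map_poly of_int m)) x = of_real (coeff (companion_poly r) i) + (x - of_real \<beta>) * ?t i"
      unfolding map_poly_m_complex poly_shift_linear_mult
      using poly_poly_shift[of i "companion_poly_complex r" x] by (simp add: coeff_companion_poly_complex algebra_simps)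
    show "of_int (srs_ext r z i) * poly (poly_shift (Suc i) (map_poly of_int m)) x =
        of_real (coeff (companion_poly r) i * real_of_int (srs_ext r z i)) + (x - of_real \<beta>) * (of_int (srs_ext r z i) * ?t i)"
      unfolding eq by (simp add: algebra_simps)
  qed
  also have "\<dots> = of_real (frac (srs_dot r z)) + (x - of_real \<beta>) * (\<Sum>i<Suc CARD('n). of_int (srs_ext r z i) * ?t i)"
    unfolding sum.distrib sum_distrib_left[symmetric] frac_srs_dot_eq_sum of_real_sum ..
  also have "(\<Sum>i<Suc CARD('n). of_int (srs_ext r z i) * ?t i) = (\<Sum>i<CARD('n). of_int (srs_ext r z i) * ?t i)"
    by (simp add: poly_shift_eq_0)
  also have "\<dots> = left_eig r x (int_vec z)"
    unfolding left_eig_def by (intro sum.cong) (simp_all add: srs_ext_def int_vec_def)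
  finally show ?thesis by simp
qed

text \<open>The number to be embedded is the value of \<open>monom 1 n * srs_poly z\<close> at
  \<beta>; the eigenvalue relation absorbs \<open>x^n\<close> into the power of the companion
  matrix.\<close>

lemma conj_image_beta_power:
  assumes "j \<in> {1..CARD('n)}"
  shows "conj_image \<beta> (b j) (\<beta> ^ n * frac (srs_dot r z)) =
    (b j - of_real \<beta>) * left_eig r (b j) (mat_power (companion r) n *v int_vec z) + of_real (frac (srs_dot r z)) * b j ^ n"
proof -
  have mon: "poly (map_poly of_int (monom 1 n * g)) x = x ^ n * poly (map_poly of_int g) x"
    for g and x :: "'b::{idom, ring_char_0}"
    by (simp add: map_poly_of_int_mult map_poly_monom poly_monom)
  have "conj_image \<beta> (b j) (poly (map_poly of_int (monom 1 n * srs_poly z)) \<beta>) = poly (map_poly of_int (monom 1 n * srs_poly z)) (b j)"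
    by (rule conj_image_poly_of_int[OF min_poly(2,3)[OF algebraic_int_beta] conjugate(1)[OF assms]])
  then show ?thesis
    unfolding mon poly_srs_poly_beta poly_srs_poly_complex left_eig_mat_power[OF conjugate(4)[OF assms]]
    by (simp add: algebra_simps)
qed

section \<open>Conjugacy with the beta-transformation\<close>

text \<open>Modulo integers, \<open>coeff_m_Suc\<close> turns \<open>r (\<tau> z)\<close> into
  \<beta> times the sum for \<open>{r z}\<close> without its first term, and \<beta> times that term
  is an integer by \<open>coeff_m_0\<close>.\<close>

lemma frac_srs_dot_srs_map: "frac (srs_dot r (srs_map r z)) = beta_map \<beta> (frac (srs_dot r z))"
proof -
  let ?R = "coeff (companion_poly r)" and ?z = "srs_ext r z"
  have "srs_dot r (srs_map r z) = (\<Sum>i<CARD('n). ?R i * real_of_int (?z (Suc i)))"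
    unfolding srs_dot_eq_sum_coeff by (intro sum.cong) (simp_all add: srs_map_nth_eq_srs_ext)
  also have "\<dots> = (\<Sum>i<CARD('n). real_of_int (coeff m (Suc i) * ?z (Suc i)) + \<beta> * (?R (Suc i) * real_of_int (?z (Suc i))))"
    by (intro sum.cong) (simp_all add: coeff_m_Suc algebra_simps)
  also have "\<dots> = of_int (\<Sum>i<CARD('n). coeff m (Suc i) * ?z (Suc i)) + \<beta> * (\<Sum>i<CARD('n). ?R (Suc i) * real_of_int (?z (Suc i)))"
    by (simp add: sum.distrib sum_distrib_left)
  also have "(\<Sum>i<CARD('n). ?R (Suc i) * real_of_int (?z (Suc i))) = frac (srs_dot r z) - ?R 0 * ?z 0"
    unfolding frac_srs_dot_eq_sum by (subst sum.lessThan_Suc_shift) simp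
  finally have "srs_dot r (srs_map r z) =
      \<beta> * frac (srs_dot r z) + real_of_int ((\<Sum>i<CARD('n). coeff m (Suc i) * ?z (Suc i)) + coeff m 0 * ?z 0)"
    by (simp add: coeff_m_0 algebra_simps)
  then show ?thesis by (simp only: beta_map_eq_frac frac_add_of_int_right)
qed

text \<open>\<open>{r z}\<close> is the value at \<beta> of a polynomial of degree below that of the
  minimal polynomial, so it vanishes only if all tail weights do. The comparison of preimages of 0
  rests on this.\<close>

lemma frac_srs_dot_eq_0_iff: "frac (srs_dot r z) = 0 \<longleftrightarrow> z = 0"
proof
  assume "frac (srs_dot r z) = 0"
  then have "rpoly (map_poly of_int (srs_poly z)) \<beta> = 0" by (simp only: rpoly_of_int poly_srs_poly_beta)
  then have dvd: "map_poly rat_of_int m dvd map_poly rat_of_int (srs_poly z)"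
    using rpoly_eq_0_iff_dvd[OF min_poly(2,3)[OF algebraic_int_beta]] min_poly_eq by simp
  have "degree (srs_poly z) < degree m" unfolding srs_poly_def by (rule degree_tail_comb) (simp add: degree_m)
  then have "map_poly rat_of_int (srs_poly z) = 0"
    using dvd_imp_degree_le[OF dvd] by (auto simp: degree_map_poly)
  then have "srs_poly z = 0" by (subst (asm) map_poly_eq_0_iff) simp_all
  then have "srs_ext r z i = 0" if "i < Suc CARD('n)" for i
    using tail_comb_eq_0D[OF lead_coeff_m, of "srs_ext r z" i] that by (simp add: srs_poly_def degree_m)
  then show "z = 0" by (intro vec_eq_at_posI) (metis less_SucI srs_ext_def zero_index)
qed (simp add: srs_dot_def)

lemma frac_srs_dot_funpow: "frac (srs_dot r ((srs_map r ^^ n) z)) = (beta_map \<beta> ^^ n) (frac (srs_dot r z))"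
  by (induction n) (simp_all add: frac_srs_dot_srs_map)

lemma srs_map_funpow_eq_0_iff: "(srs_map r ^^ n) z = 0 \<longleftrightarrow> (beta_map \<beta> ^^ n) (frac (srs_dot r z)) = 0"
  using frac_srs_dot_eq_0_iff[of "(srs_map r ^^ n) z"] by (simp add: frac_srs_dot_funpow)

text \<open>
  The \<open>\<int>\<close>-span of \<open>r\<^sub>0, \<dots>, r\<^sub>d\<^sub>-\<^sub>1, 1\<close> is \<open>\<int>[\<beta>]\<close>; as \<open>\<beta>\<close> is a unit, it is closed under
  division by \<open>\<beta>\<close>.
\<close>

lemma span_div_beta:
  assumes "\<beta> * y - of_int k = (\<Sum>i<Suc CARD('n). coeff (companion_poly r) i * real_of_int (w i))"
  obtains v where "y = (\<Sum>i<Suc CARD('n). coeff (companion_poly r) i * real_of_int (v i))"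
proof -
  let ?R = "coeff (companion_poly r)"
  have Rd: "?R CARD('n) = 1" by (simp add: coeff_companion_poly)
  \<comment> \<open>The entries of \<open>w\<close> move up by one place; \<open>v 0\<close> solves
    an integer equation whose coefficient \<open>- coeff m 0\<close> is 1 or -1 and thus its own
    inverse.\<close>
  define v where "v i = (case i of 0 \<Rightarrow> - coeff m 0 * (w CARD('n) + k + (\<Sum>i<CARD('n). coeff m (Suc i) * w i)) | Suc i \<Rightarrow> w i)" for i
  have "- coeff m 0 * v 0 = w CARD('n) + k + (\<Sum>i<CARD('n). coeff m (Suc i) * w i)"
    unfolding v_def using coeff_m_0_square by (simp add: mult.assoc[symmetric])
  then have "- real_of_int (coeff m 0) * real_of_int (v 0) = real_of_int (w CARD('n) + k + (\<Sum>i<CARD('n). coeff m (Suc i) * w i))"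
    by (metis of_int_minus of_int_mult)
  then have 0: "\<beta> * (?R 0 * real_of_int (v 0)) = real_of_int (w CARD('n) + k) + (\<Sum>i<CARD('n). real_of_int (coeff m (Suc i)) * real_of_int (w i))"
    by (simp add: coeff_m_0 mult.assoc)
  have "\<beta> * (\<Sum>i<Suc CARD('n). ?R i * real_of_int (v i)) =
      \<beta> * (?R 0 * real_of_int (v 0)) + (\<Sum>i<CARD('n). \<beta> * ?R (Suc i) * real_of_int (w i))"
    by (subst sum.lessThan_Suc_shift) (simp add: distrib_left sum_distrib_left v_def mult.assoc)
  also have "\<dots> = real_of_int (w CARD('n) + k) + (\<Sum>i<CARD('n). ?R i * real_of_int (w i))"
    unfolding 0 add.assoc sum.distrib[symmetric] by (simp add: coeff_m_Suc algebra_simps)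
  also have "\<dots> = \<beta> * y" using assms by (simp add: Rd)
  finally have "y = (\<Sum>i<Suc CARD('n). ?R i * real_of_int (v i))" using beta_gt_1 by simp
  then show ?thesis by (rule that)
qed

text \<open>Going back from 0, each step solves \<open>\<beta> y - k = w\<close> with integer
  \<open>k\<close>, which does not leave the span.\<close>

lemma beta_map_preimage_in_span:
  assumes "(beta_map \<beta> ^^ n) y = 0"
  obtains v where "y = (\<Sum>i<Suc CARD('n). coeff (companion_poly r) i * real_of_int (v i))"
proof -
  have "\<exists>v. y = (\<Sum>i<Suc CARD('n). coeff (companion_poly r) i * real_of_int (v i))"
    using assms
  proof (induction n arbitrary: y)
    case 0
    then show ?case by (intro exI[of _ "\<lambda>_. 0"]) simp
  next
    case (Suc n)
    have "(beta_map \<beta> ^^ n) (beta_map \<beta> y) = 0" using Suc.prems by (simp add: funpow_swap1)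
    then obtain w where "beta_map \<beta> y = (\<Sum>i<Suc CARD('n). coeff (companion_poly r) i * real_of_int (w i))"
      using Suc.IH by blast
    then show ?case using span_div_beta[of y] unfolding beta_map_def by metis
  qed
  then show ?thesis using that by blast
qed

lemma beta_map_preimage_eq:
  "{y \<in> {0..<1}. (beta_map \<beta> ^^ n) y = 0} = (\<lambda>z. frac (srs_dot r z)) ` {z. (srs_map r ^^ n) z = 0}"
proof (intro equalityI subsetI)
  fix y assume y: "y \<in> {y \<in> {0..<1}. (beta_map \<beta> ^^ n) y = 0}"
  then obtain v where v: "y = (\<Sum>i<Suc CARD('n). coeff (companion_poly r) i * real_of_int (v i))"
    using beta_map_preimage_in_span by blast
  \<comment> \<open>The coefficient of 1, at index d, is dropped: this changes
    \<open>srs_dot r z\<close> by an integer only, and \<open>y\<close> in [0, 1) is recovered as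
    fractional part.\<close>
  define z :: "int ^ 'n::{finite, linorder}" where "z = (\<chi> i. v (pos i))"
  have "srs_dot r z = (\<Sum>i<CARD('n). coeff (companion_poly r) i * real_of_int (v i))"
    unfolding srs_dot_eq_sum_coeff by (intro sum.cong) (simp_all add: z_def)
  then have "srs_dot r z = y - real_of_int (v CARD('n))" unfolding v by (simp add: coeff_companion_poly)
  then have "frac (srs_dot r z) = y" using y by (simp add: frac_unique_iff)
  then show "y \<in> (\<lambda>z. frac (srs_dot r z)) ` {z. (srs_map r ^^ n) z = 0}"
    using y by (intro image_eqI[of _ _ z]) (simp_all add: srs_map_funpow_eq_0_iff)
next
  fix y assume "y \<in> (\<lambda>z. frac (srs_dot r z)) ` {z. (srs_map r ^^ n) z = 0}"
  then show "y \<in> {y \<in> {0..<1}. (beta_map \<beta> ^^ n) y = 0}"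
    by (auto simp: srs_map_funpow_eq_0_iff frac_lt_1)
qed

section \<open>Comparison of the two approximations\<close>

text \<open>The linear isomorphism between the two sides; its inverse is the map of the
  claim.\<close>

definition pack_eig :: "real ^ 'n::{finite, linorder} \<Rightarrow> real ^ 'n::{finite, linorder}" where
  "pack_eig v = pack p b (\<lambda>x. (x - of_real \<beta>) * left_eig r x v)"

lemma linear_pack_eig: "linear pack_eig"
proof (rule linearI)
  show "pack_eig (v + w) = pack_eig v + pack_eig w" for v w
    unfolding pack_eig_def pack_add[symmetric] by (simp add: left_eig_add distrib_left)
  show "pack_eig (c *\<^sub>R v) = c *\<^sub>R pack_eig v" for c v
    unfolding pack_eig_def pack_scaleR[symmetric] by (simp add: left_eig_scaleR mult.left_commute)
qed

text \<open>If the recorded coordinates vanish, so do the values at all d conjugates; none of these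
  equals \<beta>, so \<open>left_eig\<close> vanishes at d distinct points.\<close>

lemma pack_eig_eq_0D:
  assumes "pack_eig v = 0"
  shows "v = 0"
proof (rule left_eig_eq_0D[where S = "b ` {1..CARD('n)}" and r = r])
  have ord: "CARD('n) = p + 2 * s" "inj_on b {1..CARD('n)}" "\<And>j. j \<in> {1..p} \<Longrightarrow> b j \<in> \<real>"
    "\<And>j. j \<in> {1..s} \<Longrightarrow> b (p + j) = cnj (b (p + s + j))"
    using ordering unfolding conj_ordering_def bij_betw_def by blast+
  show "CARD('n) \<le> card (b ` {1..CARD('n)})" using ord(2) by (simp add: card_image)
  fix x assume "x \<in> b ` {1..CARD('n)}"
  then obtain j where j: "x = b j" "j \<in> {1..CARD('n)}" by blast
  let ?f = "\<lambda>x. (x - complex_of_real \<beta>) * left_eig r x v"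
  have cnj_f: "cnj (?f x) = ?f (cnj x)" for x by (simp add: cnj_left_eig)
  have "?f (b j) = 0"
  proof (rule pack_eq_0D[OF assms[unfolded pack_eig_def] ord(1) _ _ j(2)])
    show "?f (b j) \<in> \<real>" if "j \<in> {1..p}" for j
      using ord(3)[OF that] cnj_f[of "b j"] by (simp add: Reals_cnj_iff)
    show "?f (b (p + s + j)) = cnj (?f (b (p + j)))" if "j \<in> {1..s}" for j
      unfolding cnj_f ord(4)[OF that] by simp
  qed
  then show "left_eig r x v = 0" using conjugate(2)[OF j(2)] j(1) by simp
qed simp

definition beta_approx :: "nat \<Rightarrow> (real ^ 'n::{finite, linorder}) set" where
  "beta_approx n = (\<lambda>y. beta_embed \<beta> p b (\<beta> ^ n * y)) ` {y \<in> {0..<1}. (beta_map \<beta> ^^ n) y = 0}"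

text \<open>The second summand is the error; it tends to 0 since the listed conjugates have modulus
  below 1.\<close>

lemma beta_embed_power:
  "beta_embed \<beta> p b (\<beta> ^ n * frac (srs_dot r z)) = pack_eig (mat_power (companion r) n *v int_vec z)
     + frac (srs_dot r z) *\<^sub>R (pack p b (\<lambda>x. x ^ n) :: real ^ 'n::{finite, linorder})"
  unfolding beta_embed_eq_pack pack_eig_def pack_scaleR[symmetric] pack_add[symmetric]
  by (rule pack_cong) (rule conj_image_beta_power)

lemma beta_approx_eq:
  "beta_approx n = (\<lambda>z. pack_eig (mat_power (companion r) n *v int_vec z)
     + frac (srs_dot r z) *\<^sub>R pack p b (\<lambda>x. x ^ n)) ` {z. (srs_map r ^^ n) z = 0}"
  unfolding beta_approx_def beta_map_preimage_eq image_image beta_embed_power ..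

text \<open>For \<open>y\<close> in [0, 1), the number \<open>y / \<beta>\<close> is a preimage
  under \<open>beta_map\<close>, and \<open>\<beta>^(n+1) (y / \<beta>) = \<beta>^n y\<close> gives
  the same point.\<close>

lemma incseq_beta_approx: "incseq beta_approx"
proof (rule incseq_SucI, rule subsetI)
  fix n t assume "t \<in> beta_approx n"
  then obtain y where y: "0 \<le> y" "y < 1" "(beta_map \<beta> ^^ n) y = 0" "t = beta_embed \<beta> p b (\<beta> ^ n * y)"
    unfolding beta_approx_def by auto
  have "beta_map \<beta> (y / \<beta>) = y" using y beta_gt_1 by (simp add: beta_map_eq_frac frac_eq)
  then have "(beta_map \<beta> ^^ Suc n) (y / \<beta>) = 0" using y(3) by (simp add: funpow_swap1)
  moreover have "y / \<beta> \<in> {0..<1}" using y beta_gt_1 by (simp add: field_simps)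
  moreover have "t = beta_embed \<beta> p b (\<beta> ^ Suc n * (y / \<beta>))" using y(4) beta_gt_1 by simp
  ultimately show "t \<in> beta_approx (Suc n)" unfolding beta_approx_def by blast
qed

lemma beta_approx_nonempty: "beta_approx n \<noteq> {}"
proof -
  have "(srs_map r ^^ n) 0 = 0" by (induction n) simp_all
  then show ?thesis unfolding beta_approx_eq by blast
qed

text \<open>One step of \<open>srs_map r\<close> changes \<open>left_eig r x\<close> of a vector by a factor \<open>x\<close>, up to a bounded term.\<close>

lemma norm_left_eig_mat_power_le:
  assumes x: "poly (companion_poly_complex r) x = 0" "cmod x < 1" and z: "(srs_map r ^^ n) z = 0"
  shows "cmod (left_eig r x (mat_power (companion r) n *v int_vec z)) \<le> cmod (left_eig r x last_unit) / (1 - cmod x)"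
proof -
  let ?C = "cmod (left_eig r x last_unit)"
  have "cmod (x ^ n * left_eig r x (int_vec z)) \<le> ?C * (\<Sum>k<n. cmod x ^ k)"
    using z
  proof (induction n arbitrary: z)
    case 0
    then have "int_vec z = 0 *\<^sub>R int_vec z" by (simp add: int_vec_def vec_eq_iff)
    then have "left_eig r x (int_vec z) = 0" by (metis left_eig_scaleR mult_zero_left of_real_0)
    then show ?case by simp
  next
    case (Suc n)
    have step: "x * left_eig r x (int_vec z) =
        left_eig r x (int_vec (srs_map r z)) - of_real (frac (srs_dot r z)) * left_eig r x last_unit"
      unfolding left_eig_companion[OF x(1), symmetric] companion_mult_int_vec left_eig_diff left_eig_scaleR ..
    have "x ^ Suc n * left_eig r x (int_vec z) = x ^ n * (x * left_eig r x (int_vec z))" by simp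
    also have "cmod \<dots> \<le> cmod (x ^ n * left_eig r x (int_vec (srs_map r z)))
        + cmod (x ^ n * (of_real (frac (srs_dot r z)) * left_eig r x last_unit))"
      unfolding step right_diff_distrib by (rule norm_triangle_ineq4)
    also have "\<dots> \<le> ?C * (\<Sum>k<n. cmod x ^ k) + ?C * cmod x ^ n"
    proof (rule add_mono)
      show "cmod (x ^ n * left_eig r x (int_vec (srs_map r z))) \<le> ?C * (\<Sum>k<n. cmod x ^ k)"
        by (rule Suc.IH) (use Suc.prems in \<open>simp add: funpow_swap1\<close>)
      have "cmod (x ^ n * (of_real (frac (srs_dot r z)) * left_eig r x last_unit)) = frac (srs_dot r z) * (?C * cmod x ^ n)"
        by (simp add: norm_mult norm_power)
      also have "\<dots> \<le> 1 * (?C * cmod x ^ n)"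
        using frac_lt_1[of "srs_dot r z"] by (intro mult_right_mono) simp_all
      finally show "cmod (x ^ n * (of_real (frac (srs_dot r z)) * left_eig r x last_unit)) \<le> ?C * cmod x ^ n" by simp
    qed
    finally show ?case by (simp add: distrib_left)
  qed
  also have "\<dots> \<le> ?C * (1 / (1 - cmod x))"
  proof (rule mult_left_mono)
    have "(\<Sum>k<n. cmod x ^ k) \<le> (\<Sum>k. cmod x ^ k)"
      using x(2) by (intro sum_le_suminf summable_geometric) simp_all
    then show "(\<Sum>k<n. cmod x ^ k) \<le> 1 / (1 - cmod x)" using x(2) by (simp add: suminf_geometric)
  qed simp
  finally show ?thesis unfolding left_eig_mat_power[OF x(1)] by simp
qed

text \<open>The linear part is bounded uniformly in n by \<open>norm_left_eig_mat_power_le\<close>,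
  the error part because powers of the conjugates have modulus at most 1.\<close>

lemma bounded_beta_approx: "bounded (\<Union>n. beta_approx n)"
proof -
  define C where "C j = cmod (b j - of_real \<beta>) * (cmod (left_eig r (b j) last_unit) / (1 - cmod (b j)))" for j
  have C: "0 \<le> C j" if "j \<in> {1..CARD('n)}" for j
    unfolding C_def using conjugate(3)[OF that] by simp
  have "norm t \<le> real CARD('n) * (\<Sum>j\<in>{1..CARD('n)}. C j) + real CARD('n) * 1" if t: "t \<in> beta_approx n" for t n
  proof -
    obtain z where z: "(srs_map r ^^ n) z = 0"
      "t = pack_eig (mat_power (companion r) n *v int_vec z) + frac (srs_dot r z) *\<^sub>R pack p b (\<lambda>x. x ^ n)"
      using t unfolding beta_approx_eq by blast
    have "norm (pack_eig (mat_power (companion r) n *v int_vec z)) \<le> real CARD('n) * (\<Sum>j\<in>{1..CARD('n)}. C j)"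
      unfolding pack_eig_def
    proof (rule norm_pack_le)
      fix j assume j: "j \<in> {1..CARD('n)}"
      have "cmod ((b j - of_real \<beta>) * left_eig r (b j) (mat_power (companion r) n *v int_vec z)) \<le> C j"
        unfolding C_def norm_mult
        by (intro mult_left_mono norm_left_eig_mat_power_le conjugate(3,4)[OF j] z(1)) simp
      also have "\<dots> \<le> (\<Sum>j\<in>{1..CARD('n)}. C j)" using C by (intro member_le_sum j) auto
      finally show "cmod ((b j - of_real \<beta>) * left_eig r (b j) (mat_power (companion r) n *v int_vec z)) \<le> (\<Sum>j\<in>{1..CARD('n)}. C j)" .
    qed
    moreover have "norm (frac (srs_dot r z) *\<^sub>R (pack p b (\<lambda>x. x ^ n) :: real ^ 'n::{finite, linorder})) \<le> 1 * (real CARD('n) * 1)"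
      unfolding norm_scaleR
    proof (rule mult_mono)
      show "\<bar>frac (srs_dot r z)\<bar> \<le> 1" using frac_lt_1[of "srs_dot r z"] by simp
      show "norm (pack p b (\<lambda>x. x ^ n) :: real ^ 'n::{finite, linorder}) \<le> real CARD('n) * 1"
        by (rule norm_pack_le) (use conjugate(3) in \<open>simp add: norm_power power_le_one less_imp_le\<close>)
    qed simp_all
    ultimately show ?thesis unfolding z(2) by (intro order_trans[OF norm_triangle_ineq]) simp
  qed
  then show ?thesis unfolding bounded_iff by blast
qed

lemma norm_pack_power_tendsto_0: "(\<lambda>n. norm (pack p b (\<lambda>x. x ^ n) :: real ^ 'n::{finite, linorder})) \<longlonglongrightarrow> 0"
proof -
  define \<rho> where "\<rho> = Max ((\<lambda>j. cmod (b j)) ` {1..CARD('n)})"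
  have ne: "(\<lambda>j. cmod (b j)) ` {1..CARD('n)} \<noteq> {}" by (simp add: Suc_le_eq)
  have \<rho>: "cmod (b j) \<le> \<rho>" if "j \<in> {1..CARD('n)}" for j unfolding \<rho>_def using that by (intro Max_ge) auto
  have "\<rho> \<in> (\<lambda>j. cmod (b j)) ` {1..CARD('n)}" unfolding \<rho>_def by (rule Max_in[OF _ ne]) simp
  then have "0 \<le> \<rho>" "\<rho> < 1" using conjugate(3) by auto
  then have "(\<lambda>n. real CARD('n) * \<rho> ^ n) \<longlonglongrightarrow> real CARD('n) * 0"
    by (intro tendsto_mult tendsto_const LIMSEQ_power_zero) simp
  then have lim: "(\<lambda>n. real CARD('n) * \<rho> ^ n) \<longlonglongrightarrow> 0" by simp
  have le: "norm (norm (pack p b (\<lambda>x. x ^ n) :: real ^ 'n::{finite, linorder})) \<le> real CARD('n) * \<rho> ^ n" for n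
    unfolding real_norm_def abs_norm_cancel by (rule norm_pack_le) (simp add: norm_power power_mono \<rho>)
  show ?thesis by (rule Lim_null_comparison[OF always_eventually lim]) (use le in blast)
qed

lemma srs_tile_eq_image_central_beta_tile:
  obtains f :: "real ^ 'n::{finite, linorder} \<Rightarrow> real ^ 'n::{finite, linorder}"
    where "linear f" "srs_tile r 0 = f ` central_beta_tile \<beta> p b"
proof -
  have "inj pack_eig" using pack_eig_eq_0D linear_injective_0[OF linear_pack_eig] by blast
  then obtain g where g: "linear g" "\<And>v. g (pack_eig v) = v" "\<And>v. pack_eig (g v) = v"
    using linear_injective_isomorphism[OF linear_pack_eig] by blast
  have lip: "\<exists>K. K-lipschitz_on UNIV h" if "linear h" for h :: "real ^ 'n::{finite, linorder} \<Rightarrow> real ^ 'n::{finite, linorder}"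
    using bounded_linear.lipschitz_boundE that linear_conv_bounded_linear by blast
  obtain K K' where K: "K-lipschitz_on UNIV pack_eig" "K'-lipschitz_on UNIV g"
    using lip[OF linear_pack_eig] lip[OF g(1)] by blast
  have close: "dist (pack_eig v) (pack_eig v + frac x *\<^sub>R w) \<le> norm w" for v w and x :: real
    using frac_lt_1[of x] by (simp add: dist_norm mult_left_le_one_le)
  have "srs_tile r 0 = lower_hausdorff_lim (srs_approx r)"
    by (simp add: srs_tile_def srs_approx_def[abs_def])
  also have "\<dots> = g ` lower_hausdorff_lim beta_approx"
  \<comment> \<open>Corresponding points arise from the same \<open>z\<close> and differ by the
    error term, whose factor \<open>{r z}\<close> is below 1.\<close>
  proof (rule lower_hausdorff_lim_perturb[OF g(2,3) K norm_pack_power_tendsto_0])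
    fix n a assume "a \<in> srs_approx r n"
    then obtain z where z: "(srs_map r ^^ n) z = 0" "a = mat_power (companion r) n *v int_vec z"
      unfolding srs_approx_def by blast
    then show "\<exists>t\<in>beta_approx n. dist (pack_eig a) t \<le> norm (pack p b (\<lambda>x. x ^ n) :: real ^ 'n::{finite, linorder})"
      unfolding beta_approx_eq using close by blast
  next
    fix n t assume "t \<in> beta_approx n"
    then obtain z where z: "(srs_map r ^^ n) z = 0"
      "t = pack_eig (mat_power (companion r) n *v int_vec z) + frac (srs_dot r z) *\<^sub>R pack p b (\<lambda>x. x ^ n)"
      unfolding beta_approx_eq by blast
    then show "\<exists>a\<in>srs_approx r n. dist (pack_eig a) t \<le> norm (pack p b (\<lambda>x. x ^ n) :: real ^ 'n::{finite, linorder})"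
      unfolding srs_approx_def using close by blast
  qed
  \<comment> \<open>For an increasing bounded sequence both limits are the closure of the
    union.\<close>
  also have "lower_hausdorff_lim beta_approx = hausdorff_lim beta_approx"
    unfolding lower_hausdorff_lim_incseq[OF incseq_beta_approx]
    using hausdorff_lim_incseq[OF incseq_beta_approx beta_approx_nonempty bounded_beta_approx] by (rule sym)
  also have "\<dots> = central_beta_tile \<beta> p b"
    unfolding central_beta_tile_def beta_approx_def[abs_def] ..
  finally have "srs_tile r 0 = g ` central_beta_tile \<beta> p b" .
  then show ?thesis by (rule that[OF g(1)])
qed

end

theorem mainTheorem1:
  shows "(\<forall>A :: int poly.
            degree A = CARD('n::{finite, linorder}) \<and> expanding A \<and>
            coeff A 0 \<ge> 2 \<and> lead_coeff A \<in> {1, - 1} \<longrightarrow>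
            (\<exists>f :: real ^ 'n::{finite, linorder} \<Rightarrow> real ^ 'n::{finite, linorder}. linear f \<and>
               srs_tile (poly_srs_param A) 0 = f ` self_affine_tile A))
       \<and> (\<forall>(\<beta> :: real) (r :: real ^ 'n::{finite, linorder}) (p :: nat) (s :: nat) (b :: nat \<Rightarrow> complex).
            unit_pisot \<beta> \<and> degree (min_poly \<beta>) = CARD('n) + 1 \<and>
            map_poly of_rat (min_poly \<beta>) =
              [:- \<beta>, 1:] * (monom 1 CARD('n) + (\<Sum>i\<in>UNIV. monom (r $ i) (pos i))) \<and>
            conj_ordering CARD('n) \<beta> p s b \<longrightarrow>
            (\<exists>f :: real ^ 'n::{finite, linorder} \<Rightarrow> real ^ 'n::{finite, linorder}. linear f \<and>
               srs_tile r 0 = f ` central_beta_tile \<beta> p b))"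
proof (intro conjI allI impI)
  fix A :: "int poly"
  assume "degree A = CARD('n) \<and> expanding A \<and> coeff A 0 \<ge> 2 \<and> lead_coeff A \<in> {1, - 1}"
  then have "srs_tile (poly_srs_param A :: real ^ 'n::{finite, linorder}) 0 = (\<lambda>v. matrix_inv (poly_V A) *v v) ` self_affine_tile A"
    by (intro srs_tile_eq_image_self_affine_tile) auto
  then show "\<exists>f :: real ^ 'n::{finite, linorder} \<Rightarrow> real ^ 'n::{finite, linorder}. linear f \<and>
      srs_tile (poly_srs_param A) 0 = f ` self_affine_tile A"
    using matrix_vector_mul_linear by blast
next
  fix \<beta> :: real and r :: "real ^ 'n::{finite, linorder}" and p s :: nat and b :: "nat \<Rightarrow> complex"
  assume *: "unit_pisot \<beta> \<and> degree (min_poly \<beta>) = CARD('n) + 1 \<and>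
      map_poly of_rat (min_poly \<beta>) = [:- \<beta>, 1:] * (monom 1 CARD('n) + (\<Sum>i\<in>UNIV. monom (r $ i) (pos i))) \<and>
      conj_ordering CARD('n) \<beta> p s b"
  \<comment> \<open>Gauss's lemma supplies the integer form of the minimal polynomial on which the
    Pisot part is built.\<close>
  obtain m where m: "min_poly \<beta> = map_poly rat_of_int m"
    using * min_poly_of_int unfolding unit_pisot_def pisot_def by blast
  have "degree m = Suc CARD('n)" using * unfolding m by (simp add: degree_map_poly)
  then show "\<exists>f :: real ^ 'n::{finite, linorder} \<Rightarrow> real ^ 'n::{finite, linorder}. linear f \<and>
      srs_tile r 0 = f ` central_beta_tile \<beta> p b"
    using * srs_tile_eq_image_central_beta_tile[OF _ _ m, of r p s b] unfolding companion_poly_def by blast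
qed

end
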